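(* There exist an absolute constant $C>0$ and a randomized algorithm (in the real RAM model described in the context), taking a parameter $K^*$, with the following property. For all integers $n\ge 2$ and $m$ with $n\le m\le n\log n$, and every $K^*$ with \[ 10\cdot\frac{\log n}{\log\left(\frac{4n}{m}\log n\right)} \le K^* \le 8(\log n)^5, \] the algorithm run on $(n,m)$ with parameter $K^*$ outputs a random vector whose law is exactly the law of the vector of bin cardinalities of $\mathrm{Multinomial}(m;1/n,\ldots,1/n)$, and its running time $T$ satisfies $\mathbb{E}[T]\le C K^*$ and $\Pr[T\le CK^*]\ge 1-e^{-\frac14 (K^* )^{1/5}}$.
   Context: $\mathrm{Multinomial}(m;1/n,\ldots,1/n)$ is the law of the loads $(N_1,\dots,N_n)$ of $n$ bins after $m$ balls are thrown independently, each into a uniformly random bin. Its vector of bin cardinalities is $(X_0,\dots,X_K)$ with $X_j=\#\{i:N_i=j\}$ and $K=\max_i N_i$. Computational model: idealized real RAM, in which real numbers are stored exactly and addition, multiplication, division, comparison, truncation, exponentiation, logarithms and trigonometric functions each take constant time, and i.i.d. $\mathrm{Uniform}(0,1)$ random variables are available at unit cost each. Logarithms are natural. *)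

theory Defs
  imports "HOL-Probability.Probability"
begin

section \<open>An idealized real RAM with a source of uniform random numbers\<close>

text \<open>
  Registers are addressed directly and memory cells indirectly, through the contents of a register;
  both hold exact real numbers. A program is a finite list of instructions that does not depend on
  the input, and its only literals are integers. Every instruction takes one unit of time.

  All operations are total, with the conventions of HOL outside their usual domains (such as
  division by zero giving zero). A program can test its operands by comparisons first, so this
  affects running times by at most a constant factor. \<open>Trunc\<close> is the floor.
\<close>

datatype unop = Move | Trunc | Exp | Ln | Sin | Cos | Tan

datatype binop = Add | Sub | Mul | Div | Pow

datatype instr =
    Const nat int
  | Unary unop nat nat
  | Binary binop nat nat nat
  | Uniform nat
  | Load nat nat
  | Store nat nat
  | JumpLe nat nat nat

type_synonym program = "instr list"

fun unop_val :: "unop \<Rightarrow> real \<Rightarrow> real" where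
  "unop_val Move x = x"
| "unop_val Trunc x = of_int \<lfloor>x\<rfloor>"
| "unop_val Exp x = exp x"
| "unop_val Ln x = ln x"
| "unop_val Sin x = sin x"
| "unop_val Cos x = cos x"
| "unop_val Tan x = tan x"

fun binop_val :: "binop \<Rightarrow> real \<Rightarrow> real \<Rightarrow> real" where
  "binop_val Add x y = x + y"
| "binop_val Sub x y = x - y"
| "binop_val Mul x y = x * y"
| "binop_val Div x y = x / y"
| "binop_val Pow x y = x powr y"

record config =
  pc :: nat
  reg :: "nat \<Rightarrow> real"
  mem :: "nat \<Rightarrow> real"
  used :: nat  \<comment> \<open>how many uniform random numbers have been consumed\<close>

text \<open>Addresses are truncated to natural numbers; negative ones refer to cell 0.\<close>

definition address :: "real \<Rightarrow> nat" where
  "address x = nat \<lfloor>x\<rfloor>"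

abbreviation set_reg :: "nat \<Rightarrow> real \<Rightarrow> config \<Rightarrow> config" where
  "set_reg d x c \<equiv> c\<lparr>pc := Suc (pc c), reg := (reg c)(d := x)\<rparr>"

text \<open>The sequence \<open>\<omega>\<close> supplies the uniform random numbers.\<close>

fun exec :: "(nat \<Rightarrow> real) \<Rightarrow> instr \<Rightarrow> config \<Rightarrow> config" where
  "exec \<omega> (Const d k) c = set_reg d (of_int k) c"
| "exec \<omega> (Unary f d a) c = set_reg d (unop_val f (reg c a)) c"
| "exec \<omega> (Binary f d a b) c = set_reg d (binop_val f (reg c a) (reg c b)) c"
| "exec \<omega> (Uniform d) c = set_reg d (\<omega> (used c)) (c\<lparr>used := Suc (used c)\<rparr>)"
| "exec \<omega> (Load d a) c = set_reg d (mem c (address (reg c a))) c"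
| "exec \<omega> (Store a b) c = c\<lparr>pc := Suc (pc c), mem := (mem c)(address (reg c a) := reg c b)\<rparr>"
| "exec \<omega> (JumpLe a b l) c = c\<lparr>pc := (if reg c a \<le> reg c b then l else Suc (pc c))\<rparr>"

definition halted :: "program \<Rightarrow> config \<Rightarrow> bool" where
  "halted P c \<longleftrightarrow> length P \<le> pc c"

definition step :: "program \<Rightarrow> (nat \<Rightarrow> real) \<Rightarrow> config \<Rightarrow> config" where
  "step P \<omega> c = (if halted P c then c else exec \<omega> (P ! pc c) c)"

text \<open>The inputs are placed in the first registers; everything else is initially zero.\<close>

definition initial :: "real list \<Rightarrow> config" where
  "initial xs = \<lparr>pc = 0, reg = (\<lambda>i. if i < length xs then xs ! i else 0), mem = (\<lambda>_. 0), used = 0\<rparr>"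

definition config_at :: "program \<Rightarrow> real list \<Rightarrow> (nat \<Rightarrow> real) \<Rightarrow> nat \<Rightarrow> config" where
  "config_at P xs \<omega> t = (step P \<omega> ^^ t) (initial xs)"

text \<open>The number of executed instructions, infinite if the run does not halt.\<close>

definition run_time :: "program \<Rightarrow> real list \<Rightarrow> (nat \<Rightarrow> real) \<Rightarrow> enat" where
  "run_time P xs \<omega> = Inf {enat t | t. halted P (config_at P xs \<omega> t)}"

text \<open>A vector of natural numbers is returned by storing its length in register 0 and its entries
  in the memory cells 0, 1, 2, and so on.\<close>

definition holds_vector :: "config \<Rightarrow> nat list \<Rightarrow> bool" where
  "holds_vector c v \<longleftrightarrow> reg c 0 = real (length v) \<and> (\<forall>j<length v. mem c j = real (v ! j))"

lemma holds_vector_unique: "holds_vector c v \<Longrightarrow> holds_vector c w \<Longrightarrow> v = w"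
  by (auto simp: holds_vector_def intro: nth_equalityI)

text \<open>The result is \<open>None\<close> if the run does not halt or halts without holding such a vector.\<close>

definition run_output :: "program \<Rightarrow> real list \<Rightarrow> (nat \<Rightarrow> real) \<Rightarrow> nat list option" where
  "run_output P xs \<omega> =
    (case run_time P xs \<omega> of
       enat t \<Rightarrow> (let c = config_at P xs \<omega> t in
         if \<exists>v. holds_vector c v then Some (THE v. holds_vector c v) else None)
     | \<infinity> \<Rightarrow> None)"

definition uniforms :: "(nat \<Rightarrow> real) measure" where
  "uniforms = (\<Pi>\<^sub>M i\<in>UNIV. uniform_measure lborel {0<..<1})"


section \<open>Bin cardinalities of the equiprobable multinomial law\<close>

text \<open>The \<open>m\<close> balls choose bins from \<open>{..<n}\<close>; the \<open>i\<close>-th load is the number of balls in bin \<open>i\<close>.\<close>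

definition multinomial_loads :: "nat \<Rightarrow> nat \<Rightarrow> nat list pmf" where
  "multinomial_loads n m =
    map_pmf (\<lambda>balls. map (count_list balls) [0..<n]) (replicate_pmf m (pmf_of_set {..<n}))"

definition bin_cardinalities :: "nat list \<Rightarrow> nat list" where
  "bin_cardinalities N = map (\<lambda>j. card {i. i < length N \<and> N ! i = j}) [0..<Suc (Max (set N))]"

definition multinomial_bin_cardinalities :: "nat \<Rightarrow> nat \<Rightarrow> nat list pmf" where
  "multinomial_bin_cardinalities n m = map_pmf bin_cardinalities (multinomial_loads n m)"

end

theory Submission
  imports Defs "HOL-Computational_Algebra.Polynomial" "HOL-Computational_Algebra.Primes"
    "HOL-Combinatorics.Multiset_Permutations"
begin

text \<open>
  The entries \<open>X\<^sub>0, X\<^sub>1, \<dots>\<close> are generated one after the other by inverting their conditional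
  distribution functions, all from a single uniform random number, and each entry costs \<open>O(1)\<close>.
  Given the previous entries, the weights of the possible values of \<open>X\<^sub>j\<close> are coefficients of a
  power of a truncated exponential series. With exact exponentiation and truncation, Kronecker
  substitution evaluates all of them at once as the digits of one large number, and dividing by
  \<open>Y - 1\<close> in base \<open>Y\<close> turns the digits into cumulative weights. How many cumulative
  weights exceed a threshold is the number of carries in a single binary addition, which by Kummer's
  theorem is the 2-adic valuation of a binomial coefficient. Factorials, binomial coefficients and
  greatest common divisors are likewise digits of numbers given by closed formulas.

  The running time is therefore an affine function of the maximal load, whose upper tail is
  controlled by Chernoff's inequality with parameter \<open>sqrt (4 n log n / m)\<close>. The law need not be
  normalised: the interval of random numbers leading to a vector has length proportional to the
  multinomial weight of that vector.
\<close>

section \<open>Straight-line code for expressions\<close>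

text \<open>The time budget and the bound on the output length are both proportional to
  \<open>K\<close>, so an entry may cost only boundedly many instructions; even a binary search in a
  conditional distribution would add a factor \<open>log n\<close>. The size of numbers is free,
  however, so closed integer formulas replace every search or summation inside a level, and the only
  loop runs over the levels. Levels are taken upwards because the truncated series for
  \<open>j + 1\<close> is the one for \<open>j\<close> minus a single term; the series for level 0
  is the integer part of \<open>m! * B ^ m * exp (1 / B)\<close>, which is why the exponents are
  reversed. A 2-adic valuation becomes computable as the logarithm of a gcd with a power of 2. In
  the Chernoff bound, \<open>z = sqrt ratio\<close> keeps the moment factor at most
  \<open>n\<close>, while \<open>z\<close> to the power \<open>2 * K\<close> equals
  \<open>ratio powr K\<close>, at least \<open>n ^ 10\<close>. Half of this exponent pays for the
  moment factor, the union bound and the worst case length \<open>m + 1 \<le> n ^ 3\<close>; the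
  other half yields \<open>exp (- K / 2)\<close>.\<close>

datatype expr = Var nat | Num int | Op1 unop expr | Op2 binop expr expr

fun val :: "(nat \<Rightarrow> real) \<Rightarrow> expr \<Rightarrow> real" where
  "val \<rho> (Var i) = \<rho> i"
| "val \<rho> (Num k) = of_int k"
| "val \<rho> (Op1 f e) = unop_val f (val \<rho> e)"
| "val \<rho> (Op2 f e1 e2) = binop_val f (val \<rho> e1) (val \<rho> e2)"

fun vars_below :: "nat \<Rightarrow> expr \<Rightarrow> bool" where
  "vars_below d (Var i) \<longleftrightarrow> i < d"
| "vars_below d (Num k) \<longleftrightarrow> True"
| "vars_below d (Op1 f e) \<longleftrightarrow> vars_below d e"
| "vars_below d (Op2 f e1 e2) \<longleftrightarrow> vars_below d e1 \<and> vars_below d e2"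

text \<open>The registers from \<open>d\<close> on form an evaluation stack: the first operand waits
  in \<open>d\<close> while the second is computed from \<open>Suc d\<close> upwards. Variables
  below \<open>d\<close> are therefore never overwritten.\<close>

fun compile :: "expr \<Rightarrow> nat \<Rightarrow> instr list" where
  "compile (Var i) d = [Unary Move d i]"
| "compile (Num k) d = [Const d k]"
| "compile (Op1 f e) d = compile e d @ [Unary f d d]"
| "compile (Op2 f e1 e2) d = compile e1 d @ compile e2 (Suc d) @ [Binary f d d (Suc d)]"

lemma vars_below_Suc: "vars_below d e \<Longrightarrow> vars_below (Suc d) e"
  by (induction e) auto

lemma val_cong: "vars_below d e \<Longrightarrow> (\<And>i. i < d \<Longrightarrow> \<rho> i = \<rho>' i) \<Longrightarrow> val \<rho> e = val \<rho>' e"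
  by (induction e) auto

lemma compile_correct:
  assumes "vars_below d e"
  shows "pc (fold (exec \<omega>) (compile e d) c) = pc c + length (compile e d)
    \<and> mem (fold (exec \<omega>) (compile e d) c) = mem c
    \<and> used (fold (exec \<omega>) (compile e d) c) = used c
    \<and> reg (fold (exec \<omega>) (compile e d) c) d = val (reg c) e
    \<and> (\<forall>i<d. reg (fold (exec \<omega>) (compile e d) c) i = reg c i)"
  using assms
proof (induction e arbitrary: d c)
  case (Op2 f e1 e2)
  define c1 where "c1 = fold (exec \<omega>) (compile e1 d) c"
  define c2 where "c2 = fold (exec \<omega>) (compile e2 (Suc d)) c1"
  have 1: "pc c1 = pc c + length (compile e1 d)" "mem c1 = mem c" "used c1 = used c"
     "reg c1 d = val (reg c) e1" "\<And>i. i < d \<Longrightarrow> reg c1 i = reg c i"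
    using Op2.IH(1)[of d c] Op2.prems by (auto simp: c1_def)
  have 2: "pc c2 = pc c1 + length (compile e2 (Suc d))" "mem c2 = mem c1" "used c2 = used c1"
     "reg c2 (Suc d) = val (reg c1) e2" "\<And>i. i < Suc d \<Longrightarrow> reg c2 i = reg c1 i"
    using Op2.IH(2)[of "Suc d" c1] Op2.prems vars_below_Suc by (auto simp: c2_def)
  have "val (reg c1) e2 = val (reg c) e2"
    using Op2.prems 1(5) by (intro val_cong[of d]) auto
  then show ?case
    using 1 2 by (simp add: c1_def[symmetric] c2_def[symmetric])
qed auto

fun straight :: "instr \<Rightarrow> bool" where
  "straight (JumpLe a b l) \<longleftrightarrow> False"
| "straight _ \<longleftrightarrow> True"

lemma straight_pc: "straight i \<Longrightarrow> pc (exec \<omega> i c) = Suc (pc c)"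
  by (cases i) auto

lemma straight_compile: "\<forall>i\<in>set (compile e d). straight i"
  by (induction e arbitrary: d) auto

text \<open>Jump-free instructions always advance the program counter by one, so a block inside a
  longer program is executed in order. This bridges the step semantics and reasoning with
  \<open>fold\<close>.\<close>

lemma run_straight:
  assumes "\<forall>i\<in>set ys. straight i" "pc c = length xs" "P = xs @ ys @ zs"
  shows "(step P \<omega> ^^ length ys) c = fold (exec \<omega>) ys c"
  using assms
proof (induction ys arbitrary: c xs)
  case (Cons y ys)
  have "step P \<omega> c = exec \<omega> y c"
    using Cons.prems by (simp add: step_def halted_def nth_append)
  moreover have "(step P \<omega> ^^ length ys) (exec \<omega> y c) = fold (exec \<omega>) ys (exec \<omega> y c)"
    using Cons.prems straight_pc[of y \<omega> c]
    by (intro Cons.IH[of _ "xs @ [y]"]) auto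
  ultimately show ?case
    by (simp add: funpow_swap1)
qed simp

text \<open>Values are computed in the scratch area from \<open>d\<close> on and then moved:
  evaluating directly into \<open>x\<close> would let the stack overwrite the registers above
  \<open>x\<close>.\<close>

definition assign_code :: "nat \<Rightarrow> (nat \<times> expr) list \<Rightarrow> instr list" where
  "assign_code d as = concat (map (\<lambda>(x, e). compile e d @ [Unary Move x d]) as)"

definition assigns :: "(nat \<times> expr) list \<Rightarrow> (nat \<Rightarrow> real) \<Rightarrow> nat \<Rightarrow> real" where
  "assigns as \<rho> = fold (\<lambda>(x, e) \<rho>. \<rho>(x := val \<rho> e)) as \<rho>"

lemma straight_assign_code: "\<forall>i\<in>set (assign_code d as). straight i"
  using straight_compile by (auto simp: assign_code_def)

lemma assigns_Cons: "val \<rho> e = v \<Longrightarrow> assigns ((x, e) # as) \<rho> = assigns as (\<rho>(x := v))"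
  by (simp add: assigns_def)

lemma assigns_Nil: "assigns [] \<rho> = \<rho>"
  by (simp add: assigns_def)

text \<open>After a compiled expression only the registers below \<open>d\<close> are known, since
  the scratch area keeps leftovers; they must not influence later assignments.\<close>

lemma assigns_cong:
  assumes "\<forall>(x, e)\<in>set as. vars_below d e" "\<And>i. i < d \<Longrightarrow> \<rho> i = \<rho>' i" "i < d"
  shows "assigns as \<rho> i = assigns as \<rho>' i"
  using assms
proof (induction as arbitrary: \<rho> \<rho>')
  case (Cons a as)
  obtain x e where a: "a = (x, e)" by (cases a)
  have "val \<rho> e = val \<rho>' e"
    using Cons.prems by (intro val_cong[of d]) (auto simp: a)
  then have "assigns as (\<rho>(x := val \<rho> e)) i = assigns as (\<rho>'(x := val \<rho>' e)) i"
    using Cons.prems by (intro Cons.IH) auto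
  then show ?case
    by (simp add: a assigns_def)
qed (simp add: assigns_Nil)

lemma assign_code_correct:
  assumes "\<forall>(x, e)\<in>set as. x < d \<and> vars_below d e"
  shows "pc (fold (exec \<omega>) (assign_code d as) c) = pc c + length (assign_code d as)
    \<and> mem (fold (exec \<omega>) (assign_code d as) c) = mem c
    \<and> used (fold (exec \<omega>) (assign_code d as) c) = used c
    \<and> (\<forall>i<d. reg (fold (exec \<omega>) (assign_code d as) c) i = assigns as (reg c) i)"
  using assms
proof (induction as arbitrary: c)
  case Nil
  then show ?case by (simp add: assign_code_def assigns_def)
next
  case (Cons a as)
  obtain x e where a: "a = (x, e)" by (cases a)
  define c1 where "c1 = fold (exec \<omega>) (compile e d) c"
  define c2 where "c2 = exec \<omega> (Unary Move x d) c1"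
  define c3 where "c3 = fold (exec \<omega>) (assign_code d as) c2"
  have 1: "pc c1 = pc c + length (compile e d)" "mem c1 = mem c" "used c1 = used c"
     "reg c1 d = val (reg c) e" "\<And>i. i < d \<Longrightarrow> reg c1 i = reg c i"
    using compile_correct[of d e \<omega> c] Cons.prems by (auto simp: a c1_def)
  have 2: "pc c2 = Suc (pc c1)" "mem c2 = mem c1" "used c2 = used c1" "reg c2 = (reg c1)(x := reg c1 d)"
    by (auto simp: c2_def)
  have 3: "pc c3 = pc c2 + length (assign_code d as)" "mem c3 = mem c2" "used c3 = used c2"
     "\<And>i. i < d \<Longrightarrow> reg c3 i = assigns as (reg c2) i"
    using Cons.IH[of c2] Cons.prems by (auto simp: a c3_def)
  have "assigns as (reg c2) i = assigns as ((reg c)(x := val (reg c) e)) i" if "i < d" for i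
    using that Cons.prems 1 2 by (intro assigns_cong[of _ d]) auto
  moreover have "fold (exec \<omega>) (assign_code d (a # as)) c = c3"
    by (simp add: assign_code_def a c3_def c2_def c1_def)
  moreover have "length (assign_code d (a # as)) = length (compile e d) + 1 + length (assign_code d as)"
    by (simp add: assign_code_def a)
  ultimately show ?case
    using 1 2 3 by (simp add: a assigns_def)
qed

lemma halted_mono:
  assumes "halted P (config_at P xs \<omega> t)" "t \<le> t'"
  shows "halted P (config_at P xs \<omega> t')"
  using assms(2,1)
  by (induction rule: dec_induct) (auto simp: config_at_def step_def)

lemma run_time_eqI:
  assumes "halted P (config_at P xs \<omega> (Suc t))" "\<not> halted P (config_at P xs \<omega> t)"
  shows "run_time P xs \<omega> = enat (Suc t)"
  unfolding run_time_def
proof (rule antisym)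
  show "Inf {enat t |t. halted P (config_at P xs \<omega> t)} \<le> enat (Suc t)"
    by (rule Inf_lower) (use assms in auto)
  have "Suc t \<le> t'" if "halted P (config_at P xs \<omega> t')" for t'
    using halted_mono[OF that, of t] assms(2) by (meson not_less_eq_eq)
  then show "enat (Suc t) \<le> Inf {enat t |t. halted P (config_at P xs \<omega> t)}"
    by (auto intro!: Inf_greatest)
qed

lemma run_output_eqI:
  assumes "run_time P xs \<omega> = enat t" "holds_vector (config_at P xs \<omega> t) v"
  shows "run_output P xs \<omega> = Some v"
proof -
  have "(THE v. holds_vector (config_at P xs \<omega> t) v) = v"
    using assms(2) holds_vector_unique by blast
  then show ?thesis
    using assms by (auto simp: run_output_def Let_def)
qed

section \<open>Digits, carries and valuations\<close>

lemma digit_sum: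
  fixes c :: "nat \<Rightarrow> nat"
  assumes "\<And>i. c i < B"
  shows "(\<Sum>i<N. c i * B ^ i) div B ^ s mod B = (if s < N then c s else 0)"
  using assms
proof (induction N arbitrary: c s)
  case (Suc N)
  have B: "B > 0" using Suc.prems[of 0] by simp
  have eq: "(\<Sum>i<Suc N. c i * B ^ i) = c 0 + B * (\<Sum>i<N. c (Suc i) * B ^ i)"
    by (simp add: sum.lessThan_Suc_shift sum_distrib_left mult_ac del: sum.lessThan_Suc)
  show ?case
  proof (cases s)
    case 0
    then show ?thesis using Suc.prems[of 0] unfolding eq by simp
  next
    case (Suc s')
    have "(c 0 + B * (\<Sum>i<N. c (Suc i) * B ^ i)) div B ^ s
        = (\<Sum>i<N. c (Suc i) * B ^ i) div B ^ s'"
      using B Suc.prems[of 0] by (simp add: Suc div_mult2_eq)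
    then show ?thesis
      using Suc.IH[of "\<lambda>i. c (Suc i)" s'] Suc.prems unfolding eq by (simp add: Suc)
  qed
qed simp

lemma digit_poly:
  fixes p :: "nat poly"
  assumes "\<And>i. coeff p i < B"
  shows "poly p B div B ^ s mod B = coeff p s"
proof -
  have "poly p B = (\<Sum>i<Suc (degree p). coeff p i * B ^ i)"
    by (simp add: poly_altdef lessThan_Suc_atMost)
  then show ?thesis
    using digit_sum[of "coeff p" B "Suc (degree p)" s] assms coeff_eq_0[of p s]
    by (auto simp del: sum.lessThan_Suc)
qed

text \<open>With natural coefficients the value at 1 is their sum. This supplies the bound that
  \<open>digit_poly\<close> asks for.\<close>

lemma coeff_le_poly_1:
  fixes p :: "nat poly"
  shows "coeff p i \<le> poly p 1"
proof (cases "i \<le> degree p")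
  case True
  then have "coeff p i \<le> (\<Sum>i\<le>degree p. coeff p i)"
    by (intro member_le_sum) auto
  then show ?thesis by (simp add: poly_altdef)
qed (simp add: coeff_eq_0)

text \<open>Expand \<open>(1 + x) ^ a\<close> in base \<open>x = 2 ^ Suc a\<close>: the coefficients
  are at most \<open>2 ^ a\<close>, so they do not overflow and appear as the digits.\<close>

lemma binomial_digit:
  "(1 + 2 ^ Suc a) ^ a div (2 ^ Suc a) ^ b mod 2 ^ Suc a = a choose b" for a b :: nat
proof -
  have "(\<Sum>i<Suc a. (a choose i) * (2 ^ Suc a) ^ i) = (1 + 2 ^ Suc a :: nat) ^ a"
    using binomial_ring[of "2 ^ Suc a :: nat" 1 a]
    by (simp add: lessThan_Suc_atMost add_ac del: power_Suc sum.lessThan_Suc)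
  moreover have "a choose i < 2 ^ Suc a" for i
    using binomial_le_pow2[of a i] by (simp add: less_le_trans le_less_trans)
  ultimately show ?thesis
    using digit_sum[of "\<lambda>i. a choose i" "2 ^ Suc a" "Suc a" b]
    by (auto simp: not_less simp del: power_Suc sum.lessThan_Suc)
qed

text \<open>Julia Robinson's formula. The ratio of \<open>B ^ m\<close> to the falling factorial of
  \<open>B\<close> exceeds 1 only slightly, by Bernoulli's inequality, and the assumption on
  \<open>B\<close> makes that estimate strong enough to keep \<open>B ^ m / (B choose m)\<close>
  below \<open>fact m + 1\<close>.\<close>

lemma fact_eq_div_binomial:
  assumes "B > m\<^sup>2 * (fact m + 1)"
  shows "B ^ m div (B choose m) = fact m"
proof -
  have mB: "m \<le> B"
  proof -
    have "m \<le> m\<^sup>2" by (simp add: power2_eq_square)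
    also have "\<dots> \<le> m\<^sup>2 * (fact m + 1)" by simp
    finally show ?thesis using assms by linarith
  qed
  have pos: "B choose m > 0" using mB by simp
  have upper: "(B choose m) * fact m \<le> B ^ m"
    by (rule binomial_fact_pow)
  have Bpos: "real B > 0" using assms by simp
  have "(1 - real m / real B) ^ m \<ge> 1 - real m * (real m / real B)"
    using Bernoulli_inequality[of "- (real m / real B)" m] mB Bpos by simp
  then have "real B ^ m * (1 - real m * (real m / real B)) \<le> real B ^ m * (1 - real m / real B) ^ m"
    using Bpos by (intro mult_left_mono) auto
  also have "\<dots> = (real B - real m) ^ m"
    using Bpos by (simp add: power_mult_distrib[symmetric] field_simps)
  also have "\<dots> = (\<Prod>i<m. real B - real m)" by simp
  also have "\<dots> \<le> (\<Prod>i<m. real (B - i))"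
    using mB by (intro prod_mono) (auto simp: of_nat_diff)
  also have "\<dots> = real ((B choose m) * fact m)"
    using mB by (simp add: binomial_altdef_of_nat prod_dividef fact_prod_rev atLeast0LessThan of_nat_diff)
  finally have lower: "real B ^ m * (1 - (real m)\<^sup>2 / real B) \<le> real (B choose m) * fact m"
    by (simp add: power2_eq_square)
  have "real (m\<^sup>2 * (fact m + 1)) < real B"
    using assms by (simp only: of_nat_less_iff)
  then have "(real m)\<^sup>2 * (fact m + 1) < real B"
    by (simp add: algebra_simps)
  then have "(1 - (real m)\<^sup>2 / real B) * (fact m + 1) > fact m"
    using Bpos by (simp add: field_simps)
  then have "real B ^ m * ((1 - (real m)\<^sup>2 / real B) * (fact m + 1)) > real B ^ m * fact m"
    using Bpos by simp
  also have "real B ^ m * ((1 - (real m)\<^sup>2 / real B) * (fact m + 1))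
     \<le> real (B choose m) * fact m * (fact m + 1)"
    using mult_right_mono[OF lower, of "fact m + 1"] by (simp add: mult_ac)
  finally have "fact m * real B ^ m < fact m * (real (B choose m) * (fact m + 1))"
    by (simp add: mult_ac)
  then have "real B ^ m < real (B choose m) * (fact m + 1)"
    by (rule mult_left_less_imp_less) simp
  then have "real (B ^ m) < real ((B choose m) * (fact m + 1))"
    by (simp add: algebra_simps)
  then have "B ^ m < (B choose m) * (fact m + 1)"
    by (simp only: of_nat_less_iff)
  then show ?thesis
    using upper by (intro div_nat_eqI) (auto simp: mult_ac)
qed

section \<open>Binary weight and the theorems of Legendre and Kummer at the prime 2\<close>

fun hamming :: "nat \<Rightarrow> nat" where
  "hamming n = (if n = 0 then 0 else n mod 2 + hamming (n div 2))"

declare hamming.simps [simp del]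

lemma hamming_0 [simp]: "hamming 0 = 0"
  by (simp add: hamming.simps)

lemma hamming_double [simp]: "hamming (2 * n) = hamming n" "hamming (Suc (2 * n)) = Suc (hamming n)"
proof -
  show "hamming (2 * n) = hamming n"
    by (subst hamming.simps) auto
  show "hamming (Suc (2 * n)) = Suc (hamming n)"
    by (subst hamming.simps) auto
qed

text \<open>Legendre's formula at 2, written additively to avoid truncated subtraction. The even
  factors of \<open>fact (2 * k)\<close> contribute \<open>2 ^ k * fact k\<close> and the odd ones
  nothing (\<open>dbl\<close>), which matches the recursion of \<open>hamming\<close> under
  halving.\<close>

lemma multiplicity_2_fact: "multiplicity 2 (fact n :: nat) + hamming n = n"
proof (induction n rule: less_induct)
  case (less n)
  have dbl: "multiplicity 2 (fact (2 * k) :: nat) = k + multiplicity 2 (fact k :: nat)" for k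
  proof (induction k)
    case (Suc k)
    have "multiplicity 2 (fact (2 * Suc k) :: nat)
        = multiplicity 2 (2 * (Suc k * (Suc (2 * k) * fact (2 * k))) :: nat)"
      by (simp add: algebra_simps)
    also have "\<dots> = Suc (multiplicity 2 (Suc k) + (multiplicity 2 (Suc (2 * k)) + multiplicity 2 (fact (2 * k) :: nat)))"
      by (simp add: prime_elem_multiplicity_mult_distrib multiplicity_times_same del: mult_Suc mult_Suc_right)
    also have "multiplicity 2 (Suc (2 * k)) = 0"
      by (simp add: not_dvd_imp_multiplicity_0)
    also have "Suc (multiplicity 2 (Suc k) + (0 + multiplicity 2 (fact (2 * k) :: nat)))
       = Suc k + multiplicity 2 (Suc k * fact k :: nat)"
      using Suc by (simp add: prime_elem_multiplicity_mult_distrib del: mult_Suc mult_Suc_right)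
    finally show ?case by (simp del: mult_Suc mult_Suc_right)
  qed simp
  show ?case
  proof (cases "n = 0")
    case False
    define k where "k = n div 2"
    have "k < n" using False by (simp add: k_def)
    note IH = less.IH[OF this]
    consider "n = 2 * k" | "n = Suc (2 * k)" unfolding k_def by linarith
    then show ?thesis
    proof cases
      case 1
      then show ?thesis using IH dbl[of k] by simp
    next
      case 2
      have "multiplicity 2 (fact n :: nat) = multiplicity 2 (Suc (2 * k)) + multiplicity 2 (fact (2 * k) :: nat)"
        unfolding 2 fact_Suc by (simp add: prime_elem_multiplicity_mult_distrib del: mult_Suc mult_Suc_right)
      also have "multiplicity 2 (Suc (2 * k)) = 0"
        by (simp add: not_dvd_imp_multiplicity_0)
      finally show ?thesis using IH dbl[of k] 2 by simp
    qed
  qed simp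
qed

text \<open>Kummer's theorem at 2: every carry in the addition \<open>a + b\<close> lowers the
  binary weight by one, so the loss of weight counts the carries.\<close>

lemma multiplicity_2_binomial:
  "multiplicity 2 ((a + b) choose b) + hamming (a + b) = hamming a + hamming b"
proof -
  have "fact (a + b) = ((a + b) choose b) * (fact a * fact b :: nat)"
    using binomial_fact_lemma[of b "a + b"] by (simp add: mult_ac)
  then have "multiplicity 2 (fact (a + b) :: nat)
    = multiplicity 2 ((a + b) choose b) + (multiplicity 2 (fact a :: nat) + multiplicity 2 (fact b :: nat))"
    by (simp add: prime_elem_multiplicity_mult_distrib)
  then show ?thesis
    using multiplicity_2_fact[of a] multiplicity_2_fact[of b] multiplicity_2_fact[of "a + b"] by linarith
qed

lemma hamming_append: "a < 2 ^ l \<Longrightarrow> hamming (a + 2 ^ l * b) = hamming a + hamming b"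
proof (induction l arbitrary: a)
  case (Suc l)
  have IH: "hamming (a div 2 + 2 ^ l * b) = hamming (a div 2) + hamming b"
    using Suc.prems by (intro Suc.IH) auto
  consider "a = 2 * (a div 2)" | "a = Suc (2 * (a div 2))" by linarith
  then show ?case
  proof cases
    case 1
    then have "a + 2 ^ Suc l * b = 2 * (a div 2 + 2 ^ l * b)" by simp
    then show ?thesis using IH 1 by (metis hamming_double(1))
  next
    case 2
    then have "a + 2 ^ Suc l * b = Suc (2 * (a div 2 + 2 ^ l * b))" by simp
    then show ?thesis using IH 2 by (metis hamming_double(2) add_Suc)
  qed
qed simp

lemma hamming_packed:
  assumes "\<And>k. t k < 2 ^ l"
  shows "hamming (\<Sum>k<N. t k * (2 ^ l) ^ k) = (\<Sum>k<N. hamming (t k))"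
  using assms
proof (induction N arbitrary: t)
  case (Suc N)
  have "(\<Sum>k<Suc N. t k * (2 ^ l) ^ k) = t 0 + 2 ^ l * (\<Sum>k<N. t (Suc k) * (2 ^ l) ^ k)"
    by (simp add: sum.lessThan_Suc_shift sum_distrib_left mult_ac del: sum.lessThan_Suc)
  then show ?case
    using Suc.IH[of "\<lambda>k. t (Suc k)"] Suc.prems hamming_append[of "t 0" l]
    by (simp add: sum.lessThan_Suc_shift del: sum.lessThan_Suc)
qed simp

lemma hamming_2_power: "hamming (2 ^ w) = 1"
proof -
  have "hamming 1 = 1" by (subst hamming.simps) simp
  then show ?thesis using hamming_append[of 0 w 1] by simp
qed

text \<open>The comparison gadget. Below \<open>2 * 2 ^ w\<close> the test
  \<open>2 ^ w \<le> t\<close> just reads bit \<open>w\<close>; adding \<open>2 ^ w\<close> moves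
  that bit up one place if it is set and sets it otherwise.\<close>

lemma hamming_add_2_power:
  assumes "t < 2 * 2 ^ w"
  shows "hamming (t + 2 ^ w) = (if 2 ^ w \<le> t then hamming t else Suc (hamming t))"
proof (cases "2 ^ w \<le> t")
  case True
  define t' where "t' = t - 2 ^ w"
  have t: "t = t' + 2 ^ w * 1" "t' < 2 ^ w" using True assms by (auto simp: t'_def)
  have 1: "hamming t = hamming t' + 1"
    using hamming_append[OF t(2), of 1] hamming_2_power[of 0] t by simp
  have "t + 2 ^ w = t' + 2 ^ Suc w * 1" using t by simp
  then have "hamming (t + 2 ^ w) = hamming t' + hamming 1"
    using hamming_append[of t' "Suc w" 1] t(2) by (simp only:) simp
  then show ?thesis using True 1 hamming_2_power[of 0] by simp
next
  case False
  then show ?thesis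
    using hamming_append[of t w 1] hamming_2_power[of 0] by simp
qed

text \<open>Adding \<open>2 ^ w\<close> to every digit of a packed number produces a carry exactly in the digits
  that are at least \<open>2 ^ w\<close>, and by Kummer's theorem the carries are counted by the valuation of a
  binomial coefficient.\<close>

lemma multiplicity_2_packed_carries:
  fixes t :: "nat \<Rightarrow> nat" and w N :: nat
  assumes "\<And>k. t k < 2 * 2 ^ w"
  defines "Y \<equiv> 4 * 2 ^ w"
  defines "T \<equiv> (\<Sum>k<N. t k * Y ^ k)" and "M \<equiv> 2 ^ w * (\<Sum>k<N. Y ^ k)"
  shows "multiplicity 2 ((T + M) choose M) = card {k. k < N \<and> 2 ^ w \<le> t k}"
proof -
  have Y: "Y = 2 ^ (w + 2)" by (simp add: Y_def)
  \<comment> \<open>The base is \<open>4 * 2 ^ w\<close> because a digit plus \<open>2 ^ w\<close>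
    stays below \<open>3 * 2 ^ w\<close>: carries arise inside digits and never pass from one digit
    to the next.\<close>
  have tY: "t k < 2 ^ (w + 2)" "t k + 2 ^ w < 2 ^ (w + 2)" for k
    using assms(1)[of k] by auto
  have M: "M = (\<Sum>k<N. 2 ^ w * Y ^ k)"
    by (simp add: M_def sum_distrib_left)
  have TM: "T + M = (\<Sum>k<N. (t k + 2 ^ w) * Y ^ k)"
    by (simp add: M T_def sum.distrib algebra_simps)
  have "hamming T = (\<Sum>k<N. hamming (t k))"
    unfolding T_def Y by (rule hamming_packed) (rule tY)
  moreover have "hamming M = (\<Sum>k<N. hamming (2 ^ w))"
    unfolding M Y by (rule hamming_packed) simp
  moreover have "hamming (T + M) = (\<Sum>k<N. hamming (t k + 2 ^ w))"
    unfolding TM Y by (rule hamming_packed) (rule tY)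
  moreover have "(\<Sum>k<N. hamming (t k)) + (\<Sum>k<N. hamming (2 ^ w))
      = (\<Sum>k<N. hamming (t k + 2 ^ w)) + (\<Sum>k<N. if 2 ^ w \<le> t k then 1 else 0)"
    unfolding sum.distrib[symmetric]
    by (rule sum.cong) (auto simp: hamming_add_2_power[OF assms(1)] hamming_2_power)
  moreover have "(\<Sum>k<N. if 2 ^ w \<le> t k then 1 else 0) = card {k. k < N \<and> 2 ^ w \<le> t k}"
    by (simp add: sum.If_cases Int_def)
  ultimately show ?thesis
    using multiplicity_2_binomial[of T M] by linarith
qed

section \<open>The greatest common divisor as a lattice point count\<close>

lemma geometric_sum_nat: "(x :: nat) > 1 \<Longrightarrow> (\<Sum>i<n. x ^ i) = (x ^ n - 1) div (x - 1)"
proof -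
  assume x: "x > 1"
  have "(x - 1) * (\<Sum>i<n. x ^ i) = x ^ n - 1"
  proof (induction n)
    case (Suc n)
    have "x ^ n \<ge> 1" using x by simp
    moreover have "x ^ n \<le> x * x ^ n" using x by simp
    ultimately show ?case using Suc by (simp add: algebra_simps)
  qed simp
  then show ?thesis using x by (metis nonzero_mult_div_cancel_left zero_less_diff less_irrefl)
qed

text \<open>The segment from \<open>(0, a)\<close> to \<open>(b, 0)\<close> carries the lattice
  points \<open>(b' * i, a - a' * i)\<close> with \<open>i \<le> g\<close>: in
  \<open>a' * s = b' * (a - t)\<close>, coprimality forces \<open>b'\<close> to divide
  \<open>s\<close>.\<close>

lemma card_lattice_gcd:
  fixes a b :: nat
  assumes "a > 0" "b > 0"
  shows "card {(s, t). s \<le> b \<and> t \<le> a \<and> a * s + b * t = a * b} = gcd a b + 1"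
proof -
  define g where "g = gcd a b"
  define a' b' where "a' = a div g" and "b' = b div g"
  have g: "g > 0" using assms by (simp add: g_def)
  have a: "a = g * a'" and b: "b = g * b'" by (simp_all add: a'_def b'_def g_def)
  have cop: "coprime a' b'" unfolding a'_def b'_def g_def using assms div_gcd_coprime by blast
  have pos: "a' > 0" "b' > 0" using assms a b by auto
  have "bij_betw (\<lambda>i. (b' * i, a - a' * i)) {..g} {(s, t). s \<le> b \<and> t \<le> a \<and> a * s + b * t = a * b}"
  proof (rule bij_betwI')
    fix i j assume "i \<in> {..g}" "j \<in> {..g}"
    then show "((b' * i, a - a' * i) = (b' * j, a - a' * j)) = (i = j)"
      using pos by auto
  next
    fix i assume i: "i \<in> {..g}"
    then have "a' * i \<le> a" by (simp add: a)
    have "a * (b' * i) + b * (a - a' * i) = a * b"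
      using \<open>a' * i \<le> a\<close> unfolding a b by (simp add: algebra_simps diff_mult_distrib2)
    then show "(b' * i, a - a' * i) \<in> {(s, t). s \<le> b \<and> t \<le> a \<and> a * s + b * t = a * b}"
      using i by (simp add: b)
  next
    fix x assume "x \<in> {(s, t). s \<le> b \<and> t \<le> a \<and> a * s + b * t = a * b}"
    then obtain s t where x: "x = (s, t)" "s \<le> b" "t \<le> a" "a * s + b * t = a * b" by auto
    have "a * s = b * (a - t)" using x by (simp add: diff_mult_distrib2 algebra_simps)
    then have eq: "a' * s = b' * (a - t)" using g unfolding a b by (simp add: mult.assoc)
    then have "b' dvd a' * s" by simp
    then have "b' dvd s" using cop by (simp add: coprime_commute coprime_dvd_mult_right_iff)
    then obtain i where i: "s = b' * i" by auto
    have "i \<le> g" using x(2) pos unfolding i b by (simp add: mult.commute)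
    moreover have "a' * i = a - t" using eq pos unfolding i by (simp add: mult.left_commute)
    then have "t = a - a' * i" using x(3) by simp
    ultimately show "\<exists>i\<in>{..g}. x = (b' * i, a - a' * i)" using i x(1) by auto
  qed
  from bij_betw_same_card[OF this] show ?thesis by (simp add: g_def)
qed

text \<open>The product of the two geometric sums is the generating function of \<open>a s + b t\<close>, so its
  digit at position \<open>a b\<close> counts the lattice points on a segment.\<close>

lemma gcd_digit:
  fixes a b X :: nat
  assumes "a > 0" "b > 0" "X > b + 1"
  shows "((\<Sum>s<Suc b. (X ^ a) ^ s) * (\<Sum>t<Suc a. (X ^ b) ^ t)) div X ^ (a * b) mod X = gcd a b + 1"
proof -
  define Box where "Box = {..b} \<times> {..a}"
  define f where "f = (\<lambda>(s, t). a * s + b * t)"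
  define c where "c i = card {z \<in> Box. f z = i}" for i
  have fin: "finite Box" by (simp add: Box_def)
  have c_le: "c i < X" for i
  proof -
    \<comment> \<open>On a line \<open>a * s + b * t = i\<close> the coordinate \<open>s\<close>
      determines \<open>t\<close>, so a digit is at most \<open>b + 1\<close>; hence the assumption
      on \<open>X\<close>.\<close>
    have "inj_on fst {z \<in> Box. f z = i}"
      using assms by (auto simp: inj_on_def f_def)
    then have "c i = card (fst ` {z \<in> Box. f z = i})"
      by (simp add: c_def card_image)
    also have "\<dots> \<le> card {..b}"
      by (intro card_mono) (auto simp: Box_def)
    finally show ?thesis using assms by simp
  qed
  have f_le: "f z < Suc (2 * a * b)" if zB: "z \<in> Box" for z
  proof -
    obtain s t where z: "z = (s, t)" "s \<le> b" "t \<le> a" using zB by (cases z) (auto simp: Box_def)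
    have "a * s \<le> a * b" "b * t \<le> b * a" using z by (auto intro!: mult_le_mono)
    then have "a * s + b * t \<le> 2 * (a * b)" by (simp only: mult.commute[of b a] mult_2 add_mono)
    then show ?thesis by (simp add: z f_def mult.assoc)
  qed
  then have f_image: "f ` Box \<subseteq> {..<Suc (2 * a * b)}" by blast
  have "(\<Sum>s<Suc b. (X ^ a) ^ s) * (\<Sum>t<Suc a. (X ^ b) ^ t) = (\<Sum>z\<in>Box. X ^ f z)"
    unfolding Box_def lessThan_Suc_atMost sum_product sum.cartesian_product f_def
    by (rule sum.cong) (auto simp: power_add power_mult)
  also have "\<dots> = (\<Sum>i<Suc (2 * a * b). \<Sum>z\<in>{z \<in> Box. f z = i}. X ^ f z)"
    by (simp only: sum.group[OF fin finite_lessThan f_image])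
  also have "\<dots> = (\<Sum>i<Suc (2 * a * b). c i * X ^ i)"
    by (intro sum.cong) (auto simp: c_def)
  finally have "((\<Sum>s<Suc b. (X ^ a) ^ s) * (\<Sum>t<Suc a. (X ^ b) ^ t)) div X ^ (a * b) mod X = c (a * b)"
    using digit_sum[of c X "Suc (2 * a * b)" "a * b"] c_le by (simp del: sum.lessThan_Suc)
  also have "c (a * b) = gcd a b + 1"
    unfolding card_lattice_gcd[OF assms(1,2), symmetric] c_def
    by (rule arg_cong[of _ _ card]) (auto simp: Box_def f_def)
  finally show ?thesis .
qed

text \<open>Translates a valuation into a gcd, which \<open>gcd_digit\<close> makes computable; a
  logarithm to base 2 then returns the exponent.\<close>

lemma gcd_2_power:
  assumes "(y::nat) > 0" "multiplicity 2 y \<le> N"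
  shows "gcd y (2 ^ N) = 2 ^ multiplicity 2 y"
proof -
  define v where "v = multiplicity 2 y"
  obtain u where u: "y = 2 ^ v * u" "\<not> 2 dvd u"
    using multiplicity_decompose'[of y 2] assms by (auto simp: v_def)
  have "2 ^ N = 2 ^ v * (2 ^ (N - v) :: nat)"
    using assms by (simp add: v_def power_add[symmetric])
  then have "gcd y (2 ^ N) = 2 ^ v * gcd u (2 ^ (N - v))"
    unfolding u(1) by (simp only: gcd_mult_distrib_nat)
  also have "gcd u (2 ^ (N - v)) = 1"
    using u by (simp add: coprime_iff_gcd_eq_1[symmetric])
  finally show ?thesis by (simp add: v_def)
qed

section \<open>Sequential inversion\<close>

text \<open>Scaled by \<open>fact m\<close>, the coefficients \<open>1 / fact j\<close> of the
  exponential series are integers for \<open>j \<le> m\<close>, as digit extraction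
  requires.\<close>

definition inv_fact_coeff :: "nat \<Rightarrow> nat \<Rightarrow> nat" where
  "inv_fact_coeff m j = fact m div fact j"

text \<open>The exponential generating function of a load that is at least \<open>j\<close>, multiplied by \<open>m!\<close> and
  with the exponents \<open>i\<close> reversed to \<open>m - i\<close>.\<close>

definition level_poly :: "nat \<Rightarrow> nat \<Rightarrow> nat poly" where
  "level_poly m j = (\<Sum>i\<in>{j..m}. monom (inv_fact_coeff m i) (m - i))"

text \<open>In \<open>level_total m p s j\<close> there are \<open>p\<close> bins left, all of load at least \<open>j\<close>, and \<open>s\<close> is the
  sum of \<open>m\<close> minus the load over these bins; \<open>level_part m p s j k\<close> is the contribution of the
  configurations with exactly \<open>k\<close> bins of load \<open>j\<close>.\<close>

definition level_total :: "nat \<Rightarrow> nat \<Rightarrow> nat \<Rightarrow> nat \<Rightarrow> nat" where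
  "level_total m p s j = coeff (level_poly m j ^ p) s"

definition level_part :: "nat \<Rightarrow> nat \<Rightarrow> nat \<Rightarrow> nat \<Rightarrow> nat \<Rightarrow> nat" where
  "level_part m p s j k = (if k * (m - j) \<le> s
     then (p choose k) * inv_fact_coeff m j ^ k * level_total m (p - k) (s - k * (m - j)) (Suc j) else 0)"

text \<open>Summation from above, because multiplication by
  \<open>Y / (Y - 1) = 1 + 1 / Y + ...\<close> in \<open>packed_tails\<close> produces suffix
  sums.\<close>

definition level_tail :: "nat \<Rightarrow> nat \<Rightarrow> nat \<Rightarrow> nat \<Rightarrow> nat \<Rightarrow> nat" where
  "level_tail m p s j k = (\<Sum>k'\<in>{k..p}. level_part m p s j k')"

lemma inv_fact_coeff_pos: "j \<le> m \<Longrightarrow> inv_fact_coeff m j > 0"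
  by (simp add: inv_fact_coeff_def div_greater_zero_iff fact_mono_nat)

lemma inv_fact_coeff_le: "inv_fact_coeff m j \<le> fact m"
  by (simp add: inv_fact_coeff_def)

lemma real_inv_fact_coeff: "j \<le> m \<Longrightarrow> real (inv_fact_coeff m j) = fact m / fact j"
  by (simp add: inv_fact_coeff_def real_of_nat_div fact_dvd)

lemma level_poly_step:
  "j \<le> m \<Longrightarrow> level_poly m j = monom (inv_fact_coeff m j) (m - j) + level_poly m (Suc j)"
  by (simp add: level_poly_def sum.atLeast_Suc_atMost)

lemma level_poly_eq_0: "m < j \<Longrightarrow> level_poly m j = 0"
  by (simp add: level_poly_def)

text \<open>The extra factor \<open>y\<close> marks the number \<open>k\<close> of bins of the
  current load. With \<open>y = 1\<close> this splits \<open>level_total\<close> in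
  \<open>tail_0\<close>; with \<open>y = Y\<close> it gives the packing in
  \<open>packed_parts\<close>.\<close>

lemma coeff_binomial_power:
  fixes q :: "nat poly"
  shows "coeff ((monom (y * c) e + q) ^ p) s
    = (\<Sum>k\<le>p. (if k * e \<le> s then (p choose k) * c ^ k * coeff (q ^ (p - k)) (s - k * e) else 0) * y ^ k)"
proof -
  have "coeff (of_nat (p choose k) * monom (y * c) e ^ k * q ^ (p - k)) s
     = (if k * e \<le> s then (p choose k) * c ^ k * coeff (q ^ (p - k)) (s - k * e) else 0) * y ^ k" for k
  proof -
    have mono_pow: "monom (y * c) e ^ k = smult ((y * c) ^ k) (monom 1 (k * e))"
      by (simp add: monom_power smult_monom mult.commute[of e k])
    have "of_nat (p choose k) * monom (y * c) e ^ k * q ^ (p - k)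
      = smult ((p choose k) * (y * c) ^ k) (monom 1 (k * e) * q ^ (p - k))"
      by (simp add: of_nat_poly mono_pow mult.commute[of "p choose k"])
    then have "coeff (of_nat (p choose k) * monom (y * c) e ^ k * q ^ (p - k)) s
       = (p choose k) * (y * c) ^ k * (if s < k * e then 0 else coeff (q ^ (p - k)) (s - k * e))"
      by (simp only: coeff_smult coeff_monom_mult mult_1)
    then show ?thesis
      by (auto simp: power_mult_distrib)
  qed
  then show ?thesis
    by (simp add: binomial_ring coeff_sum)
qed

lemma tail_0: "j \<le> m \<Longrightarrow> level_tail m p s j 0 = level_total m p s j"
  using coeff_binomial_power[of 1 "inv_fact_coeff m j" "m - j" "level_poly m (Suc j)" p s]
  by (simp add: level_total_def level_tail_def level_part_def level_poly_step[of j m] atMost_atLeast0 cong: if_cong)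

lemma tail_step: "k \<le> p \<Longrightarrow> level_tail m p s j k = level_part m p s j k + level_tail m p s j (Suc k)"
  by (simp add: level_tail_def sum.atLeast_Suc_atMost)

lemma tail_eq_0: "p < k \<Longrightarrow> level_tail m p s j k = 0"
  by (simp add: level_tail_def)

lemma tail_antimono: "k \<le> k' \<Longrightarrow> level_tail m p s j k' \<le> level_tail m p s j k"
  unfolding level_tail_def by (intro sum_mono2) auto

text \<open>Tails decrease in \<open>k\<close>, so for a threshold below the total this is the last
  \<open>k\<close> whose tail exceeds the threshold, the inverse of the conditional distribution
  function. It is phrased as a count because carries will be counted.\<close>

definition pick :: "nat \<Rightarrow> nat \<Rightarrow> nat \<Rightarrow> nat \<Rightarrow> real \<Rightarrow> nat" where
  "pick m p s j u = card {k. 1 \<le> k \<and> k \<le> p \<and> u * real (level_tail m p s j 0) < real (level_tail m p s j k)}"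

lemma pick_le: "pick m p s j u \<le> p"
proof -
  have "pick m p s j u \<le> card {1..p}"
    unfolding pick_def by (intro card_mono) auto
  then show ?thesis by simp
qed

lemma pick_eqI:
  assumes "k \<le> p" "real (level_tail m p s j (Suc k)) \<le> u * real (level_tail m p s j 0)"
    "u * real (level_tail m p s j 0) < real (level_tail m p s j k)"
  shows "pick m p s j u = k"
proof -
  have "u * real (level_tail m p s j 0) < real (level_tail m p s j i) \<longleftrightarrow> i \<le> k" for i
  proof (cases "i \<le> k")
    case True
    then show ?thesis
      using assms(3) tail_antimono[of i k m p s j] by simp
  next
    case False
    then show ?thesis
      using assms(2) tail_antimono[of "Suc k" i m p s j] by simp
  qed
  then have "{k. 1 \<le> k \<and> k \<le> p \<and> u * real (level_tail m p s j 0) < real (level_tail m p s j k)}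
      = {i. 1 \<le> i \<and> i \<le> p \<and> i \<le> k}"
    by (simp only:)
  also have "\<dots> = {1..k}"
    using assms(1) by auto
  finally show ?thesis by (simp add: pick_def)
qed

lemma pick_bounds:
  assumes "0 \<le> u" "u < 1" "level_tail m p s j 0 > 0"
  shows "real (level_tail m p s j (Suc (pick m p s j u))) \<le> u * real (level_tail m p s j 0)"
    and "u * real (level_tail m p s j 0) < real (level_tail m p s j (pick m p s j u))"
proof -
  define x where "x = u * real (level_tail m p s j 0)"
  have 0: "x < real (level_tail m p s j 0)" "0 \<le> x" using assms by (simp_all add: x_def)
  define k where "k = Max {k. k \<le> p \<and> x < real (level_tail m p s j k)}"
  have fin: "finite {k. k \<le> p \<and> x < real (level_tail m p s j k)}" by simp
  have ne: "{k. k \<le> p \<and> x < real (level_tail m p s j k)} \<noteq> {}" using 0 by auto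
  have k: "k \<le> p" "x < real (level_tail m p s j k)"
    using Max_in[OF fin ne] by (auto simp: k_def)
  have "real (level_tail m p s j (Suc k)) \<le> x"
  proof (cases "Suc k \<le> p")
    case True
    show ?thesis
    proof (rule ccontr)
      assume "\<not> ?thesis"
      then have "Suc k \<le> k" using True unfolding k_def by (intro Max_ge[OF fin]) auto
      then show False by simp
    qed
  next
    case False
    then show ?thesis using 0 by (simp add: tail_eq_0)
  qed
  moreover from this k have "pick m p s j u = k"
    by (intro pick_eqI) (simp_all add: x_def)
  ultimately show "real (level_tail m p s j (Suc (pick m p s j u))) \<le> u * real (level_tail m p s j 0)"
    and "u * real (level_tail m p s j 0) < real (level_tail m p s j (pick m p s j u))"
    using k by (simp_all add: x_def)
qed

text \<open>The position of \<open>u\<close> within the interval selected by \<open>pick\<close>; it is again uniform and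
  serves as the random number of the next level.\<close>

definition rescale :: "nat \<Rightarrow> nat \<Rightarrow> nat \<Rightarrow> nat \<Rightarrow> real \<Rightarrow> real" where
  "rescale m p s j u = (let k = pick m p s j u in
     (u * real (level_tail m p s j 0) - real (level_tail m p s j (Suc k)))
       / (real (level_tail m p s j k) - real (level_tail m p s j (Suc k))))"

text \<open>The test \<open>m < j\<close> secures termination. By \<open>level_le\<close> a state of
  positive total with bins left has \<open>j \<le> m\<close>, so the machine loop can decide by
  \<open>p\<close> alone.\<close>

function decode :: "nat \<Rightarrow> nat \<Rightarrow> nat \<Rightarrow> nat \<Rightarrow> real \<Rightarrow> nat list" where
  "decode m p s j u = (if p = 0 \<or> m < j then [] else
     let k = pick m p s j u
     in k # decode m (p - k) (s - k * (m - j)) (Suc j) (rescale m p s j u))"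
  by auto
termination by (relation "Wellfounded.measure (\<lambda>(m, p, s, j, u). Suc m - j)") auto

declare decode.simps [simp del]

lemma total_0: "level_total m 0 s j = (if s = 0 then 1 else 0)"
  by (simp add: level_total_def)

lemma total_beyond: "m < j \<Longrightarrow> p > 0 \<Longrightarrow> level_total m p s j = 0"
  by (simp add: level_total_def level_poly_eq_0 zero_power)

lemma level_le: "0 < level_total m p s j \<Longrightarrow> 0 < p \<Longrightarrow> j \<le> m"
  using total_beyond[of m j p s] by (cases "m < j") auto

lemma decode_step_props:
  assumes "0 \<le> u" "u < 1" "0 < level_total m p s j" "0 < p"
  defines "k \<equiv> pick m p s j u"
  shows "level_part m p s j k > 0" "k \<le> p" "k * (m - j) \<le> s"
    "0 < level_total m (p - k) (s - k * (m - j)) (Suc j)"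
    "0 \<le> rescale m p s j u" "rescale m p s j u < 1"
proof -
  have "j \<le> m" using assms level_le by blast
  then have pos: "level_tail m p s j 0 > 0" using assms by (simp add: tail_0)
  note b = pick_bounds[OF assms(1,2) pos, folded k_def]
  show k: "k \<le> p" unfolding k_def by (rule pick_le)
  show part: "level_part m p s j k > 0"
    using b tail_step[OF k, of m s j] by (cases "level_part m p s j k = 0") auto
  then show "k * (m - j) \<le> s" "0 < level_total m (p - k) (s - k * (m - j)) (Suc j)"
    by (auto simp: level_part_def split: if_splits)
  show "0 \<le> rescale m p s j u" "rescale m p s j u < 1"
    using b part tail_step[OF k, of m s j] by (simp_all add: rescale_def Let_def k_def[symmetric])
qed

text \<open>Entries are allowed only while bins are left, and the list ends exactly when none are.
  This excludes trailing zeros, as the last entry of a vector of bin cardinalities is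
  positive.\<close>

fun valid :: "nat \<Rightarrow> nat \<Rightarrow> nat \<Rightarrow> nat \<Rightarrow> nat list \<Rightarrow> bool" where
  "valid m p s j [] \<longleftrightarrow> p = 0 \<and> s = 0"
| "valid m p s j (k # v) \<longleftrightarrow> 0 < p \<and> j \<le> m \<and> k \<le> p \<and> k * (m - j) \<le> s
     \<and> valid m (p - k) (s - k * (m - j)) (Suc j) v"

fun weight :: "nat \<Rightarrow> nat \<Rightarrow> nat \<Rightarrow> nat list \<Rightarrow> nat" where
  "weight m p j [] = 1"
| "weight m p j (k # v) = (p choose k) * inv_fact_coeff m j ^ k * weight m (p - k) (Suc j) v"

lemma decode_valid:
  "0 \<le> u \<Longrightarrow> u < 1 \<Longrightarrow> 0 < level_total m p s j \<Longrightarrow> valid m p s j (decode m p s j u)"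
proof (induction m p s j u rule: decode.induct)
  case (1 m p s j u)
  show ?case
  proof (cases "p = 0")
    case True
    then show ?thesis using "1.prems" by (simp add: decode.simps total_0 split: if_splits)
  next
    case False
    then have p: "0 < p" by simp
    have j: "j \<le> m" using level_le[OF "1.prems"(3) p] .
    note props = decode_step_props[OF "1.prems" p]
    have "valid m (p - pick m p s j u) (s - pick m p s j u * (m - j)) (Suc j)
       (decode m (p - pick m p s j u) (s - pick m p s j u * (m - j)) (Suc j) (rescale m p s j u))"
      using p j props by (intro "1.IH") auto
    then show ?thesis
      using p j props by (subst decode.simps) (simp add: Let_def)
  qed
qed

lemma valid_total_pos: "valid m p s j v \<Longrightarrow> 0 < level_total m p s j"
proof (induction v arbitrary: p s j)
  case (Cons k v)
  then have "level_part m p s j k > 0"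
    by (simp add: level_part_def inv_fact_coeff_pos)
  then have "level_tail m p s j 0 > 0"
    using tail_step[of k p m s j] tail_antimono[of 0 k m p s j] Cons.prems by simp
  then show ?case using Cons.prems by (simp add: tail_0)
qed (simp add: total_0)

text \<open>Nested intervals: the numbers leading to \<open>k # v\<close> form the preimage of the
  interval of \<open>v\<close> under the affine map \<open>rescale\<close> on the block of
  \<open>k\<close>. Lengths multiply along the list, and the total of each next level cancels
  against the same factor in \<open>level_part\<close>.\<close>

lemma decode_eq_iff:
  assumes "valid m p s j v"
  shows "\<exists>a. 0 \<le> a \<and> a + real (weight m p j v) / real (level_total m p s j) \<le> 1 \<and>
    (\<forall>u. 0 \<le> u \<longrightarrow> u < 1 \<longrightarrow>
      decode m p s j u = v \<longleftrightarrow> a \<le> u \<and> u < a + real (weight m p j v) / real (level_total m p s j))"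
  using assms
proof (induction v arbitrary: p s j)
  case Nil
  then show ?case
    by (intro exI[of _ 0]) (simp add: total_0 decode.simps)
next
  case (Cons k v)
  define p' s' where "p' = p - k" and "s' = s - k * (m - j)"
  define W where "W = real (level_total m p s j)"
  define h h' where "h = real (level_tail m p s j k)" and "h' = real (level_tail m p s j (Suc k))"
  define l where "l = real (weight m p' (Suc j) v) / real (level_total m p' s' (Suc j))"
  have v: "0 < p" "j \<le> m" "k \<le> p" "k * (m - j) \<le> s" "valid m p' s' (Suc j) v"
    using Cons.prems by (simp_all add: p'_def s'_def)
  have pos: "0 < W" "0 < level_total m p' s' (Suc j)"
    using valid_total_pos[OF Cons.prems] valid_total_pos[OF v(5)] by (simp_all add: W_def)
  have tail0: "real (level_tail m p s j 0) = W" using v by (simp add: tail_0 W_def)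
  have part: "h = real (level_part m p s j k) + h'"
    using tail_step[OF v(3), of m s j] by (simp add: h_def h'_def)
  have part_pos: "level_part m p s j k > 0"
    using v pos by (simp add: level_part_def inv_fact_coeff_pos p'_def s'_def)
  have hW: "h \<le> W" using tail_antimono[of 0 k m p s j] tail0 by (simp add: h_def)
  obtain a where a: "0 \<le> a" "a + l \<le> 1"
    "\<And>u. 0 \<le> u \<Longrightarrow> u < 1 \<Longrightarrow> decode m p' s' (Suc j) u = v \<longleftrightarrow> a \<le> u \<and> u < a + l"
    using Cons.IH[OF v(5)] unfolding l_def by blast
  \<comment> \<open>The left end is the solution \<open>u\<close> of
    \<open>(u * W - h') / (h - h') = a\<close>.\<close>
  define b where "b = (h' + a * (h - h')) / W"
  have hh: "h - h' > 0" using part part_pos by simp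
  have l0: "0 \<le> l" by (simp add: l_def)
  have len: "real (weight m p j (k # v)) / W = l * (h - h') / W"
    using part v pos by (simp add: level_part_def l_def p'_def[symmetric] s'_def[symmetric])
  have "0 \<le> b" using a hh pos by (simp add: b_def h'_def)
  moreover have "b + real (weight m p j (k # v)) / W \<le> 1"
  proof -
    have "b + real (weight m p j (k # v)) / W = (h' + (a + l) * (h - h')) / W"
      unfolding len using pos by (simp add: b_def field_simps)
    also have "\<dots> \<le> (h' + 1 * (h - h')) / W"
      using a hh pos by (intro divide_right_mono add_left_mono mult_right_mono) auto
    also have "\<dots> \<le> 1" using hW pos by simp
    finally show ?thesis .
  qed
  moreover have "decode m p s j u = k # v \<longleftrightarrow> b \<le> u \<and> u < b + real (weight m p j (k # v)) / W"
    if u: "0 \<le> u" "u < 1" for u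
  proof -
    have total_pos: "0 < level_total m p s j" using pos by (simp add: W_def)
    have b1: "pick m p s j u = k \<longleftrightarrow> h' \<le> u * W \<and> u * W < h"
      using pick_eqI[OF v(3), of m s j u] pick_bounds[OF u, of m p s j] tail0 pos
      by (auto simp: h_def h'_def)
    have dec: "decode m p s j u = k # v \<longleftrightarrow> pick m p s j u = k \<and> decode m p' s' (Suc j) ((u * W - h') / (h - h')) = v"
      using v by (subst decode.simps) (auto simp: Let_def p'_def s'_def rescale_def tail0 h_def h'_def)
    have cond: "b \<le> u \<and> u < b + l * (h - h') / W \<longleftrightarrow>
        a \<le> (u * W - h') / (h - h') \<and> (u * W - h') / (h - h') < a + l"
      using pos hh unfolding b_def by (simp add: add_divide_distrib[symmetric] field_simps)
    show ?thesis
    proof (cases "h' \<le> u * W \<and> u * W < h")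
      case True
      then have "0 \<le> (u * W - h') / (h - h')" "(u * W - h') / (h - h') < 1"
        using hh by simp_all
      then show ?thesis using True dec b1 a(3) cond unfolding len by simp
    next
      case False
      \<comment> \<open>Outside the block of \<open>k\<close> the affine map leaves
        \<open>[0, 1)\<close>, whereas \<open>[a, a + l)\<close> lies inside it.\<close>
      have "\<not> (a \<le> (u * W - h') / (h - h') \<and> (u * W - h') / (h - h') < a + l)"
      proof
        assume *: "a \<le> (u * W - h') / (h - h') \<and> (u * W - h') / (h - h') < a + l"
        then have "0 \<le> (u * W - h') / (h - h')" "(u * W - h') / (h - h') < 1" using a by linarith+
        then show False using False hh by (simp add: field_simps zero_le_divide_iff)
      qed
      then show ?thesis unfolding len using False dec b1 cond by blast
    qed
  qed
  ultimately show ?case unfolding W_def by blast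
qed

lemma level_poly_at_1_le: "poly (level_poly m j) 1 \<le> Suc m * fact m"
proof -
  have "poly (level_poly m j) 1 = (\<Sum>i\<in>{j..m}. inv_fact_coeff m i)"
    by (simp add: level_poly_def poly_sum poly_monom)
  also have "\<dots> \<le> (\<Sum>i\<in>{j..m}. fact m)"
    by (intro sum_mono inv_fact_coeff_le)
  also have "\<dots> \<le> Suc m * fact m"
    by (simp del: mult_Suc)
  finally show ?thesis .
qed

text \<open>A crude bound suffices: it fixes the digit size \<open>w\<close> of the packing, and
  large digits cost no time.\<close>

lemma total_le: "p \<le> n \<Longrightarrow> level_total m p s j \<le> (Suc m * fact m) ^ n"
proof -
  assume "p \<le> n"
  have "level_total m p s j \<le> poly (level_poly m j ^ p) 1"
    unfolding level_total_def by (rule coeff_le_poly_1)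
  also have "\<dots> \<le> (Suc m * fact m) ^ p"
    unfolding poly_power by (intro power_mono level_poly_at_1_le) simp
  also have "\<dots> \<le> (Suc m * fact m) ^ n"
    using \<open>p \<le> n\<close> by (intro power_increasing) (auto simp del: mult_Suc simp: Suc_le_eq)
  finally show ?thesis .
qed

lemma tail_le: "j \<le> m \<Longrightarrow> p \<le> n \<Longrightarrow> level_tail m p s j k \<le> (Suc m * fact m) ^ n"
  using tail_antimono[of 0 k m p s j] total_le[of p n m s j] by (simp add: tail_0)

section \<open>Multinomial weights\<close>

lemma valid_iff:
  "valid m p s j v \<longleftrightarrow> sum_list v = p \<and> (\<Sum>i<length v. v ! i * (m - (j + i))) = s
    \<and> (v \<noteq> [] \<longrightarrow> 0 < last v \<and> j + length v \<le> Suc m)"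
proof (induction v arbitrary: p s j)
  case (Cons k v)
  have shift: "(\<Sum>i<length (k # v). (k # v) ! i * (m - (j + i)))
      = k * (m - j) + (\<Sum>i<length v. v ! i * (m - (Suc j + i)))"
    by (simp add: sum.lessThan_Suc_shift del: sum.lessThan_Suc)
  have last_le: "v \<noteq> [] \<Longrightarrow> last v \<le> sum_list v"
    by (simp add: member_le_sum_list)
  show ?case
    unfolding valid.simps Cons.IH shift using last_le by (cases "v = []") auto
qed auto

text \<open>The binomials chosen level by level telescope to a multinomial coefficient; multiplied
  out, the identity stays within the natural numbers.\<close>

lemma weight_prod_fact:
  "sum_list v = p \<Longrightarrow> weight m p j v * (\<Prod>i<length v. fact (v ! i))
    = fact p * (\<Prod>i<length v. inv_fact_coeff m (j + i) ^ (v ! i))"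
proof (induction v arbitrary: p j)
  case (Cons k v)
  have IH: "weight m (p - k) (Suc j) v * (\<Prod>i<length v. fact (v ! i))
    = fact (p - k) * (\<Prod>i<length v. inv_fact_coeff m (Suc j + i) ^ (v ! i))"
    using Cons.prems by (intro Cons.IH) auto
  have "weight m p j (k # v) * (\<Prod>i<length (k # v). fact ((k # v) ! i))
    = (p choose k) * inv_fact_coeff m j ^ k * fact k * (weight m (p - k) (Suc j) v * (\<Prod>i<length v. fact (v ! i)))"
    by (simp add: prod.lessThan_Suc_shift del: prod.lessThan_Suc)
  also have "\<dots> = ((fact k * fact (p - k) * (p choose k)) * inv_fact_coeff m j ^ k)
      * (\<Prod>i<length v. inv_fact_coeff m (Suc j + i) ^ (v ! i))"
    unfolding IH by (simp only: mult_ac)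
  also have "fact k * fact (p - k) * (p choose k) = fact p"
    using Cons.prems by (intro binomial_fact_lemma) auto
  finally show ?case
    by (simp add: prod.lessThan_Suc_shift mult_ac del: prod.lessThan_Suc)
qed simp

text \<open>Serves at two layers: loads count how often each bin is hit, and cardinalities count how
  often each load occurs. Both times the number of arrangements is a multinomial
  coefficient.\<close>

definition mset_of_counts :: "nat list \<Rightarrow> nat multiset" where
  "mset_of_counts v = (\<Sum>j<length v. replicate_mset (v ! j) j)"

lemma count_mset_of_counts: "count (mset_of_counts v) j = (if j < length v then v ! j else 0)"
  by (simp add: mset_of_counts_def count_sum sum.If_cases eq_commute)

lemma size_mset_of_counts: "size (mset_of_counts v) = sum_list v"
  by (simp add: mset_of_counts_def size_multiset_sum sum_list_sum_nth atLeast0LessThan)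

lemma sum_mset_of_counts: "sum_mset (mset_of_counts v) = (\<Sum>j<length v. v ! j * j)"
proof -
  have "sum_mset (\<Sum>j\<in>A. replicate_mset (v ! j) j) = (\<Sum>j\<in>A. v ! j * j)" if "finite A" for A
    using that by (induction A) auto
  then show ?thesis by (simp add: mset_of_counts_def)
qed

lemma prod_fact_mset_of_counts:
  "prod_mset (image_mset fact (mset_of_counts v)) = (\<Prod>j<length v. fact j ^ (v ! j) :: nat)"
proof -
  have "prod_mset (image_mset fact (\<Sum>j\<in>A. replicate_mset (v ! j) j)) = (\<Prod>j\<in>A. fact j ^ (v ! j) :: nat)"
    if "finite A" for A
    using that by (induction A) auto
  then show ?thesis by (simp add: mset_of_counts_def)
qed

lemma card_permutations_mset_of_counts:
  "card (permutations_of_multiset (mset_of_counts v)) * (\<Prod>j<length v. fact (v ! j)) = fact (sum_list v)"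
proof -
  have "(\<Prod>j<length v. fact (v ! j) :: nat) = (\<Prod>j<length v. fact (count (mset_of_counts v) j))"
    by (intro prod.cong) (auto simp: count_mset_of_counts)
  also have "\<dots> = (\<Prod>j\<in>set_mset (mset_of_counts v). fact (count (mset_of_counts v) j))"
  proof (rule prod.mono_neutral_right)
    show "set_mset (mset_of_counts v) \<subseteq> {..<length v}"
      by (auto simp: count_mset_of_counts simp flip: count_greater_zero_iff split: if_splits)
    show "\<forall>i\<in>{..<length v} - set_mset (mset_of_counts v). fact (count (mset_of_counts v) i) = 1"
      by (auto simp: not_in_iff)
  qed simp
  finally show ?thesis
    using card_permutations_of_multiset_aux[of "mset_of_counts v"] by (simp add: size_mset_of_counts)
qed

lemma count_mset_count_list: "count (mset xs) x = count_list xs x"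
  by (induction xs) auto

lemma mset_eq_mset_of_counts_iff:
  "mset xs = mset_of_counts v \<longleftrightarrow> (\<forall>j. count_list xs j = (if j < length v then v ! j else 0))"
  by (simp add: multiset_eq_iff count_mset_of_counts count_mset_count_list)

lemma loads_eq_iff:
  "set xs \<subseteq> {..<n} \<and> map (count_list xs) [0..<n] = N \<longleftrightarrow> length N = n \<and> mset xs = mset_of_counts N"
  unfolding mset_eq_mset_of_counts_iff
  by (auto simp: list_eq_iff_nth_eq count_list_0_iff subset_iff not_less)

text \<open>The multiset of loads determines the counts only up to trailing zeros; positivity of the
  last entry fixes the length as \<open>Max (set N) + 1\<close>.\<close>

lemma bin_cardinalities_eq_iff:
  assumes "N \<noteq> []"
  shows "bin_cardinalities N = v \<longleftrightarrow> v \<noteq> [] \<and> 0 < last v \<and> mset N = mset_of_counts v"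
proof -
  have card: "card {i. i < length N \<and> N ! i = j} = count_list N j" for j
    by (simp add: count_list_eq_length_filter length_filter_conv_card eq_commute)
  define K where "K = Max (set N)"
  have K: "K \<in> set N" "\<And>x. x \<in> set N \<Longrightarrow> x \<le> K"
    using assms by (simp_all add: K_def)
  have bc: "bin_cardinalities N = map (count_list N) [0..<Suc K]"
    by (simp add: bin_cardinalities_def card K_def)
  show ?thesis
  proof
    assume v: "bin_cardinalities N = v"
    have "last v = count_list N K" "v \<noteq> []" unfolding v[symmetric] bc by simp_all
    moreover have "count_list N K > 0" using K(1) by (meson count_list_0_iff gr0I)
    moreover have "count_list N j = (if j < length v then v ! j else 0)" for j
      unfolding v[symmetric] bc using K(2)[of j]
      by (auto simp: count_list_0_iff nth_append less_Suc_eq not_less simp del: upt_Suc)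
    ultimately show "v \<noteq> [] \<and> 0 < last v \<and> mset N = mset_of_counts v"
      by (simp add: mset_eq_mset_of_counts_iff)
  next
    assume v: "v \<noteq> [] \<and> 0 < last v \<and> mset N = mset_of_counts v"
    then have c: "count_list N j = (if j < length v then v ! j else 0)" for j
      by (simp add: mset_eq_mset_of_counts_iff)
    have "count_list N (length v - 1) \<noteq> 0" using v c[of "length v - 1"] last_conv_nth[of v] by auto
    then have "length v - 1 \<in> set N" by (meson count_list_0_iff)
    moreover have "x \<le> length v - 1" if "x \<in> set N" for x
    proof -
      have "count_list N x \<noteq> 0" using that by (simp add: count_list_0_iff)
      then show ?thesis using c[of x] by (auto split: if_splits)
    qed
    ultimately have "K = length v - 1" using K by (meson le_antisym)
    then have len: "Suc K = length v" using v by simp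
    show "bin_cardinalities N = v"
      unfolding bc len by (rule nth_equalityI) (auto simp: c)
  qed
qed

lemma pmf_replicate_pmf_of_set:
  assumes "n > 0"
  shows "pmf (replicate_pmf m (pmf_of_set {..<n})) xs
    = (if length xs = m \<and> set xs \<subseteq> {..<n} then 1 / real n ^ m else 0)"
proof (induction m arbitrary: xs)
  case (Suc m)
  have rep: "replicate_pmf (Suc m) (pmf_of_set {..<n})
      = map_pmf (\<lambda>(x, xs). x # xs) (pair_pmf (pmf_of_set {..<n}) (replicate_pmf m (pmf_of_set {..<n})))"
    by (simp add: pair_pmf_def map_bind_pmf bind_assoc_pmf bind_return_pmf map_return_pmf map_pmf_def)
  have inj: "inj (\<lambda>(x :: nat, xs). x # xs)" by (auto simp: inj_def)
  show ?case
  proof (cases xs)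
    case Nil
    have "pmf (replicate_pmf (Suc m) (pmf_of_set {..<n})) [] = 0"
      by (rule pmf_eq_0_set_pmf[THEN iffD2]) (simp add: set_replicate_pmf del: replicate_pmf.simps)
    then show ?thesis by (simp add: Nil del: replicate_pmf.simps)
  next
    case (Cons y ys)
    have "pmf (replicate_pmf (Suc m) (pmf_of_set {..<n})) (y # ys)
      = pmf (pair_pmf (pmf_of_set {..<n}) (replicate_pmf m (pmf_of_set {..<n}))) (y, ys)"
      unfolding rep using pmf_map_inj'[OF inj, of _ "(y, ys)"] by simp
    also have "\<dots> = indicator {..<n} y / real n * pmf (replicate_pmf m (pmf_of_set {..<n})) ys"
      using assms by (subst pmf_pair, subst pmf_of_set) (auto simp: lessThan_empty_iff)
    finally show ?thesis by (auto simp: Suc Cons indicator_def simp del: replicate_pmf.simps)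
  qed
qed simp

text \<open>The favourable ball sequences (\<open>Bad\<close>) are counted in two stages: the load
  vector is an arrangement of the multiset given by \<open>v\<close>, and the sequence is an
  arrangement of the multiset given by the loads. The second count is the same for all these load
  vectors, since the product \<open>F\<close> of the factorials of the loads depends on
  \<open>v\<close> only.\<close>

lemma pmf_multinomial_bin_cardinalities:
  assumes "n > 0"
  shows "pmf (multinomial_bin_cardinalities n m) v =
    (if v \<noteq> [] \<and> 0 < last v \<and> sum_list v = n \<and> (\<Sum>j<length v. v ! j * j) = m
     then fact n / (\<Prod>j<length v. fact (v ! j)) * (fact m / (\<Prod>j<length v. fact j ^ (v ! j))) / real n ^ m
     else 0)"
proof -
  define L where "L = {xs. set xs \<subseteq> {..<n} \<and> length xs = m}"
  define loads where "loads = (\<lambda>xs. map (count_list xs) [0..<n])"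
  define Bad where "Bad = {xs \<in> L. bin_cardinalities (loads xs) = v}"
  have "finite L" unfolding L_def by (rule finite_lists_length_eq) simp
  then have fin: "finite Bad" by (simp add: Bad_def)
  have "pmf (multinomial_bin_cardinalities n m) v
    = measure_pmf.prob (replicate_pmf m (pmf_of_set {..<n})) ((\<lambda>xs. bin_cardinalities (loads xs)) -` {v})"
    by (simp add: multinomial_bin_cardinalities_def multinomial_loads_def pmf_map loads_def
        pmf.map_comp o_def)
  also have "\<dots> = measure_pmf.prob (replicate_pmf m (pmf_of_set {..<n})) Bad"
    by (rule measure_prob_cong_0) (auto simp: Bad_def L_def pmf_replicate_pmf_of_set[OF assms])
  also have "\<dots> = (\<Sum>xs\<in>Bad. 1 / real n ^ m)"
    using fin by (subst measure_measure_pmf_finite)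
      (auto simp: Bad_def L_def pmf_replicate_pmf_of_set[OF assms] intro!: sum.cong)
  finally have pmf: "pmf (multinomial_bin_cardinalities n m) v = real (card Bad) / real n ^ m"
    by simp
  have loads_iff: "set xs \<subseteq> {..<n} \<and> loads xs = N \<longleftrightarrow> length N = n \<and> mset xs = mset_of_counts N" for xs N
    unfolding loads_def by (rule loads_eq_iff)
  have len_loads: "length (loads xs) = n" for xs by (simp add: loads_def)
  have loads_ne: "loads xs \<noteq> []" for xs using assms by (simp add: loads_def)
  show ?thesis
  proof (cases "v \<noteq> [] \<and> 0 < last v \<and> sum_list v = n \<and> (\<Sum>j<length v. v ! j * j) = m")
    case True
    define Ns where "Ns = permutations_of_multiset (mset_of_counts v)"
    define F where "F = (\<Prod>j<length v. fact j ^ (v ! j) :: nat)"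
    have Ns: "length N = n" "sum_list N = m" "(\<Prod>i<length N. fact (N ! i)) = F" "N \<noteq> []"
      "bin_cardinalities N = v" if "N \<in> Ns" for N
    proof -
      have ms: "mset N = mset_of_counts v" using that by (simp add: Ns_def permutations_of_multiset_def)
      show len: "length N = n"
        using arg_cong[OF ms, of size] True by (simp add: size_mset_of_counts)
      show "sum_list N = m"
        using arg_cong[OF ms, of sum_mset] True by (simp add: sum_mset_of_counts sum_mset_sum_list)
      have "(\<Prod>i<length N. fact (N ! i)) = prod_mset (image_mset fact (mset N))"
        by (induction N) (simp_all add: prod.lessThan_Suc_shift del: prod.lessThan_Suc)
      also have "\<dots> = F" unfolding ms F_def by (rule prod_fact_mset_of_counts)
      finally show "(\<Prod>i<length N. fact (N ! i)) = F" .
      show ne: "N \<noteq> []" using len assms by auto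
      show "bin_cardinalities N = v"
        using bin_cardinalities_eq_iff[OF ne, of v] True ms by simp
    qed
    have "Bad = (\<Union>N\<in>Ns. permutations_of_multiset (mset_of_counts N))"
    proof (intro set_eqI iffI)
      fix xs assume xs: "xs \<in> Bad"
      then have "mset (loads xs) = mset_of_counts v"
        using bin_cardinalities_eq_iff[OF loads_ne, of xs v] by (simp add: Bad_def)
      then have "loads xs \<in> Ns" by (simp add: Ns_def permutations_of_multiset_def)
      moreover have "mset xs = mset_of_counts (loads xs)"
        using loads_iff[of xs "loads xs"] xs by (simp add: Bad_def L_def)
      ultimately show "xs \<in> (\<Union>N\<in>Ns. permutations_of_multiset (mset_of_counts N))"
        by (auto simp: permutations_of_multiset_def)
    next
      fix xs assume "xs \<in> (\<Union>N\<in>Ns. permutations_of_multiset (mset_of_counts N))"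
      then obtain N where N: "N \<in> Ns" "mset xs = mset_of_counts N"
        by (auto simp: permutations_of_multiset_def)
      have "set xs \<subseteq> {..<n} \<and> loads xs = N" using loads_iff Ns[OF N(1)] N(2) by blast
      moreover have "length xs = m"
        using arg_cong[OF N(2), of size] Ns[OF N(1)] by (simp add: size_mset_of_counts)
      ultimately show "xs \<in> Bad" using Ns[OF N(1)] by (simp add: Bad_def L_def)
    qed
    also have "card \<dots> = (\<Sum>N\<in>Ns. card (permutations_of_multiset (mset_of_counts N)))"
    proof (rule card_UN_disjoint)
      show "\<forall>i\<in>Ns. \<forall>j\<in>Ns. i \<noteq> j \<longrightarrow>
        permutations_of_multiset (mset_of_counts i) \<inter> permutations_of_multiset (mset_of_counts j) = {}"
        using loads_iff Ns(1) by (auto simp: permutations_of_multiset_def) (metis loads_iff)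
    qed (auto simp: Ns_def)
    finally have "real (card Bad) = (\<Sum>N\<in>Ns. real (card (permutations_of_multiset (mset_of_counts N))))"
      by simp
    also have "\<dots> = (\<Sum>N\<in>Ns. fact m / real F)"
    proof (rule sum.cong)
      fix N assume N: "N \<in> Ns"
      have "real (card (permutations_of_multiset (mset_of_counts N)) * F) = fact m"
        using card_permutations_mset_of_counts[of N] Ns[OF N] by simp
      moreover have "F > 0" unfolding F_def by (intro prod_pos) auto
      ultimately show "real (card (permutations_of_multiset (mset_of_counts N))) = fact m / real F"
        by (simp add: field_simps)
    qed simp
    also have "\<dots> = real (card Ns) * (fact m / real F)" by simp
    also have "real (card Ns) = fact n / (\<Prod>j<length v. fact (v ! j))"
    proof -
      have "real (card Ns * (\<Prod>j<length v. fact (v ! j))) = fact n"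
        using card_permutations_mset_of_counts[of v] True by (simp add: Ns_def)
      moreover have "(\<Prod>j<length v. fact (v ! j) :: real) > 0" by (intro prod_pos) auto
      ultimately show ?thesis by (simp add: field_simps)
    qed
    finally show ?thesis
      using True unfolding pmf by (simp add: F_def)
  next
    case False
    have "Bad = {}"
    proof (rule equals0I)
      fix xs assume xs: "xs \<in> Bad"
      then have v: "v \<noteq> [] \<and> 0 < last v \<and> mset (loads xs) = mset_of_counts v"
        using bin_cardinalities_eq_iff[OF loads_ne, of xs v] by (simp add: Bad_def)
      then have "sum_list v = n"
        using size_mset_of_counts[of v] len_loads[of xs] size_mset[of "loads xs"] by simp
      moreover have "mset xs = mset_of_counts (loads xs)"
        using loads_iff[of xs "loads xs"] xs by (simp add: Bad_def L_def)
      then have "sum_list (loads xs) = m"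
        using size_mset_of_counts[of "loads xs"] size_mset[of xs] xs by (simp add: Bad_def L_def)
      then have "(\<Sum>j<length v. v ! j * j) = m"
        using v sum_mset_of_counts[of v] sum_mset_sum_list[of "loads xs"] by simp
      ultimately show False using v False by simp
    qed
    then show ?thesis using False unfolding pmf by auto
  qed
qed

text \<open>The start value \<open>m * n - m\<close> is the sum of \<open>m\<close> minus the load
  over \<open>n\<close> bins whose loads add up to \<open>m\<close>. Truncated subtraction is
  harmless once no load exceeds \<open>m\<close>, hence the length bounds in the proof.\<close>

lemma valid_0_iff:
  assumes "n > 0"
  shows "valid m n (m * n - m) 0 v \<longleftrightarrow>
    v \<noteq> [] \<and> 0 < last v \<and> sum_list v = n \<and> (\<Sum>j<length v. v ! j * j) = m"
proof -
  have sum_eq: "(\<Sum>j<length v. v ! j * (m - j)) + (\<Sum>j<length v. v ! j * j) = m * sum_list v"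
    if "length v \<le> Suc m"
  proof -
    have "(\<Sum>j<length v. v ! j * (m - j)) + (\<Sum>j<length v. v ! j * j) = (\<Sum>j<length v. v ! j * m)"
      unfolding sum.distrib[symmetric]
    proof (rule sum.cong)
      fix j assume "j \<in> {..<length v}"
      then have "j \<le> m" using that by simp
      then show "v ! j * (m - j) + v ! j * j = v ! j * m"
        by (simp flip: distrib_left)
    qed simp
    then show ?thesis
      by (simp add: sum_list_sum_nth atLeast0LessThan flip: sum_distrib_right)
  qed
  have mn: "m \<le> m * n" using assms by simp
  have len: "length v \<le> Suc m" if "v \<noteq> []" "0 < last v" "(\<Sum>j<length v. v ! j * j) = m"
  proof -
    have "1 * (length v - 1) \<le> v ! (length v - 1) * (length v - 1)"
      using that by (intro mult_right_mono) (simp_all add: last_conv_nth Suc_le_eq)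
    also have "\<dots> \<le> (\<Sum>j<length v. v ! j * j)"
      using that by (intro member_le_sum[of _ _ "\<lambda>j. v ! j * j"]) auto
    finally show ?thesis using that by simp
  qed
  show ?thesis
  proof
    assume val: "valid m n (m * n - m) 0 v"
    have "v \<noteq> []" using val assms by auto
    then show "v \<noteq> [] \<and> 0 < last v \<and> sum_list v = n \<and> (\<Sum>j<length v. v ! j * j) = m"
      using val sum_eq mn unfolding valid_iff by (simp; linarith)
  next
    assume A: "v \<noteq> [] \<and> 0 < last v \<and> sum_list v = n \<and> (\<Sum>j<length v. v ! j * j) = m"
    then have "length v \<le> Suc m" using len by blast
    then show "valid m n (m * n - m) 0 v"
      using A sum_eq unfolding valid_iff by (simp; linarith)
  qed
qed

text \<open>The scaling in \<open>inv_fact_coeff\<close> contributes \<open>fact m\<close> for each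
  bin, which makes \<open>fact m ^ n\<close>. What matters later is that the factor of
  proportionality does not depend on \<open>v\<close>.\<close>

lemma weight_eq_pmf:
  assumes "n > 0"
  shows "(if valid m n (m * n - m) 0 v then real (weight m n 0 v) else 0)
    = (real n ^ m * fact m ^ n / fact m) * pmf (multinomial_bin_cardinalities n m) v"
proof (cases "valid m n (m * n - m) 0 v")
  case True
  have v: "v \<noteq> [] \<and> 0 < last v \<and> sum_list v = n \<and> (\<Sum>j<length v. v ! j * j) = m"
    using True valid_0_iff[OF assms] by simp
  have len: "length v \<le> Suc m" using True unfolding valid_iff by auto
  have pos: "(\<Prod>j<length v. fact (v ! j) :: real) > 0" "(\<Prod>j<length v. fact j ^ (v ! j) :: real) > 0"
    by (intro prod_pos; simp)+
  have "real (weight m n 0 v) * (\<Prod>j<length v. fact (v ! j))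
     = fact n * (\<Prod>j<length v. real (inv_fact_coeff m j) ^ (v ! j))"
    using arg_cong[OF weight_prod_fact[of v n m 0], of real] v by simp
  also have "(\<Prod>j<length v. real (inv_fact_coeff m j) ^ (v ! j)) = (\<Prod>j<length v. fact m ^ (v ! j) / fact j ^ (v ! j))"
    using len by (intro prod.cong) (auto simp: real_inv_fact_coeff power_divide)
  also have "\<dots> = fact m ^ n / (\<Prod>j<length v. fact j ^ (v ! j))"
    using v by (simp add: prod_dividef sum_list_sum_nth atLeast0LessThan flip: power_sum)
  finally have "real (weight m n 0 v)
     = fact n / (\<Prod>j<length v. fact (v ! j)) * (fact m ^ n / (\<Prod>j<length v. fact j ^ (v ! j)))"
    using pos by (simp add: field_simps)
  then show ?thesis
    using True v pos assms by (simp add: pmf_multinomial_bin_cardinalities[OF assms])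
next
  case False
  then show ?thesis
    unfolding pmf_multinomial_bin_cardinalities[OF assms] valid_0_iff[OF assms] by (simp only: if_False if_not_P mult_zero_right)
qed

section \<open>The maximal load\<close>

text \<open>Up to the factor \<open>n ^ m\<close> this is the probability generating function of one
  load: each ball contributes \<open>z\<close> for bin \<open>b\<close> and 1 for each of the other
  \<open>n - 1\<close> bins.\<close>

lemma sum_power_count_list:
  fixes z :: real
  assumes "b < n"
  shows "(\<Sum>xs | set xs \<subseteq> {..<n} \<and> length xs = m. z ^ count_list xs b) = (real n - 1 + z) ^ m"
proof (induction m)
  case 0
  have "{xs. set xs \<subseteq> {..<n} \<and> length xs = 0} = {[]}" by auto
  then show ?case by simp
next
  case (Suc m)
  define L where "L m = {xs. set xs \<subseteq> {..<n} \<and> length xs = m}" for m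
  have L: "L (Suc m) = (\<lambda>(x, xs). x # xs) ` ({..<n} \<times> L m)"
    by (auto simp: L_def length_Suc_conv image_iff)
  have inj: "inj_on (\<lambda>(x, xs). x # xs) ({..<n} \<times> L m)" by (auto simp: inj_on_def)
  have "(\<Sum>xs\<in>L (Suc m). z ^ count_list xs b)
      = (\<Sum>(x, xs)\<in>{..<n} \<times> L m. (if x = b then z else 1) * z ^ count_list xs b)"
    unfolding L by (subst sum.reindex[OF inj]) (auto intro!: sum.cong)
  also have "\<dots> = (\<Sum>x<n. if x = b then z else 1) * (\<Sum>xs\<in>L m. z ^ count_list xs b)"
    by (simp add: sum_product sum.cartesian_product)
  also have "(\<Sum>x<n. if x = b then z else 1) = (\<Sum>x<n. (if x = b then z - 1 else 0) + 1)"
    by (intro sum.cong) auto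
  also have "\<dots> = real n - 1 + z"
    using assms by (simp add: sum.distrib)
  finally show ?case using Suc by (simp add: L_def)
qed

text \<open>Chernoff's method: Markov's inequality for \<open>z\<close> to the power of the load,
  then \<open>1 + x \<le> exp x\<close>.\<close>

lemma prob_count_list_ge:
  fixes z :: real
  assumes "b < n" "z \<ge> 1"
  shows "measure_pmf.prob (replicate_pmf m (pmf_of_set {..<n})) {xs. t \<le> count_list xs b}
    \<le> exp (real m * (z - 1) / real n) / z ^ t"
proof -
  define L where "L = {xs. set xs \<subseteq> {..<n} \<and> length xs = m}"
  have n: "n > 0" using assms by simp
  have fin: "finite L" unfolding L_def by (rule finite_lists_length_eq) simp
  have fin': "finite {xs \<in> L. t \<le> count_list xs b}" using fin by simp
  have "measure_pmf.prob (replicate_pmf m (pmf_of_set {..<n})) {xs. t \<le> count_list xs b}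
    = measure_pmf.prob (replicate_pmf m (pmf_of_set {..<n})) {xs \<in> L. t \<le> count_list xs b}"
    by (rule measure_prob_cong_0) (auto simp: L_def pmf_replicate_pmf_of_set[OF n])
  also have "\<dots> = (\<Sum>xs | xs \<in> L \<and> t \<le> count_list xs b. 1 / real n ^ m)"
    by (subst measure_measure_pmf_finite[OF fin'])
      (auto simp: L_def pmf_replicate_pmf_of_set[OF n] intro!: sum.cong)
  also have "\<dots> \<le> (\<Sum>xs | xs \<in> L \<and> t \<le> count_list xs b. z ^ count_list xs b / z ^ t / real n ^ m)"
  proof (rule sum_mono)
    fix xs assume "xs \<in> {xs. xs \<in> L \<and> t \<le> count_list xs b}"
    then have "z ^ t \<le> z ^ count_list xs b" using assms by (intro power_increasing) auto
    then have "1 \<le> z ^ count_list xs b / z ^ t" using assms by simp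
    then show "1 / real n ^ m \<le> z ^ count_list xs b / z ^ t / real n ^ m"
      by (rule divide_right_mono) simp
  qed
  also have "\<dots> \<le> (\<Sum>xs\<in>L. z ^ count_list xs b / z ^ t / real n ^ m)"
    using fin assms by (intro sum_mono2) auto
  also have "\<dots> = (real n - 1 + z) ^ m / z ^ t / real n ^ m"
    unfolding sum_divide_distrib[symmetric] L_def sum_power_count_list[OF assms(1)] ..
  also have "\<dots> = (1 + (z - 1) / real n) ^ m / z ^ t"
    using n by (simp add: divide_simps flip: power_divide) (simp add: field_simps)
  also have "\<dots> \<le> exp ((z - 1) / real n) ^ m / z ^ t"
    using assms n by (intro divide_right_mono power_mono exp_ge_add_one_self) auto
  finally show ?thesis
    by (simp add: exp_of_nat_mult[symmetric])
qed

lemma length_bin_cardinalities: "length (bin_cardinalities N) = Suc (Max (set N))"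
  by (simp add: bin_cardinalities_def)

lemma prob_length_bin_cardinalities:
  fixes z :: real
  assumes "n > 0" "z \<ge> 1"
  shows "measure_pmf.prob (multinomial_bin_cardinalities n m) {v. t < length v}
    \<le> real n * (exp (real m * (z - 1) / real n) / z ^ t)"
proof -
  let ?P = "replicate_pmf m (pmf_of_set {..<n})"
  have "measure_pmf.prob (multinomial_bin_cardinalities n m) {v. t < length v}
    = measure_pmf.prob ?P {xs. t < length (bin_cardinalities (map (count_list xs) [0..<n]))}"
    by (simp add: multinomial_bin_cardinalities_def multinomial_loads_def vimage_def)
  also have "\<dots> \<le> measure_pmf.prob ?P (\<Union>b<n. {xs. t \<le> count_list xs b})"
  proof (rule measure_pmf.finite_measure_mono)
    show "{xs. t < length (bin_cardinalities (map (count_list xs) [0..<n]))}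
      \<subseteq> (\<Union>b<n. {xs. t \<le> count_list xs b})"
    proof
      fix xs assume "xs \<in> {xs. t < length (bin_cardinalities (map (count_list xs) [0..<n]))}"
      \<comment> \<open>The length is the maximal load plus one, so a length above \<open>t\<close>
        means a load of at least \<open>t\<close>.\<close>
      then have "t \<le> Max (set (map (count_list xs) [0..<n]))"
        by (simp add: length_bin_cardinalities)
      moreover have "Max (set (map (count_list xs) [0..<n])) \<in> set (map (count_list xs) [0..<n])"
        using assms by (intro Max_in) auto
      then obtain b where "b < n" "Max (set (map (count_list xs) [0..<n])) = count_list xs b"
        by auto
      ultimately show "xs \<in> (\<Union>b<n. {xs. t \<le> count_list xs b})" by auto
    qed
  qed simp
  also have "\<dots> \<le> (\<Sum>b<n. measure_pmf.prob ?P {xs. t \<le> count_list xs b})"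
    by (rule measure_pmf.finite_measure_subadditive_finite) auto
  also have "\<dots> \<le> (\<Sum>b<n. exp (real m * (z - 1) / real n) / z ^ t)"
    by (intro sum_mono prob_count_list_ge) (use assms in auto)
  finally show ?thesis by simp
qed

lemma length_multinomial_bin_cardinalities:
  assumes "n > 0" "v \<in> set_pmf (multinomial_bin_cardinalities n m)"
  shows "length v \<le> Suc m"
proof -
  have "pmf (multinomial_bin_cardinalities n m) v \<noteq> 0"
    using assms(2) by (simp add: set_pmf_iff)
  then have "valid m n (m * n - m) 0 v"
    unfolding valid_0_iff[OF assms(1)] pmf_multinomial_bin_cardinalities[OF assms(1)]
    by (auto split: if_splits)
  then show ?thesis unfolding valid_iff by (cases "v = []") auto
qed

section \<open>Tail and mean of the output length for admissible parameters\<close>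

locale admissible =
  fixes n m :: nat and K :: real
  assumes n: "2 \<le> n" and nm: "n \<le> m" and m_le: "real m \<le> real n * ln (real n)"
    and K: "10 * (ln (real n) / ln (4 * real n / real m * ln (real n))) \<le> K"
begin

definition ratio :: real where "ratio = 4 * real n / real m * ln (real n)"

lemma ln_n: "1 \<le> ln (real n)"
proof -
  have "real n * 1 \<le> real n * ln (real n)" using m_le nm by simp
  then show ?thesis using n by (simp only: mult_le_cancel_left_pos)
qed

lemma ratio_ge: "4 \<le> ratio"
  using m_le nm n by (simp add: ratio_def field_simps)

lemma ratio_le: "ratio \<le> 4 * ln (real n)"
proof -
  have "real n * ln (real n) \<le> real m * ln (real n)"
    using nm ln_n by (intro mult_right_mono) auto
  then show ?thesis using nm n by (simp add: ratio_def field_simps)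
qed

lemma K_ln_ratio: "10 * ln (real n) \<le> K * ln ratio"
proof -
  have "ln ratio > 0" using ratio_ge by simp
  then show ?thesis using K by (simp add: ratio_def field_simps)
qed

text \<open>From \<open>ln ratio \<le> ratio \<le> 4 * ln n\<close> the lower bound on
  \<open>K\<close> gives even \<open>5 / 2\<close>. This lets additive constants be absorbed into
  multiples of \<open>K\<close>.\<close>

lemma K_ge: "2 \<le> K"
proof -
  have pos: "ln ratio > 0" using ratio_ge by simp
  have "ln ratio \<le> 4 * ln (real n)"
    using ln_bound[of ratio] ratio_ge ratio_le by linarith
  then have *: "ln ratio / ln (real n) \<le> 4" using ln_n by (simp add: field_simps)
  have "K * 4 \<ge> 10" 
  proof -
    have "0 \<le> K"
    proof (rule ccontr)
      assume "\<not> 0 \<le> K"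
      then have "K * ln ratio < 0" using pos by (simp add: mult_neg_pos)
      then show False using K_ln_ratio ln_n by linarith
    qed
    have "10 \<le> K * (ln ratio / ln (real n))"
      using K_ln_ratio ln_n by (simp add: field_simps)
    also have "\<dots> \<le> K * 4" using * \<open>0 \<le> K\<close> by (rule mult_left_mono)
    finally show ?thesis .
  qed
  then show ?thesis by simp
qed

lemma prob_long:
  "measure_pmf.prob (multinomial_bin_cardinalities n m) {v. 2 * K + 1 < real (length v)}
     \<le> exp (- K / 2) / real n ^ 3"
proof -
  define z where "z = sqrt ratio"
  define t where "t = nat \<lceil>2 * K\<rceil>"
  have z2: "z\<^sup>2 = ratio" using ratio_ge by (simp add: z_def)
  have z: "2 \<le> z" unfolding z_def using ratio_ge by (intro real_le_rsqrt) simp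
  have n0: "n > 0" using n by simp
  have t: "2 * K \<le> real t" "real t < 2 * K + 1" using K_ge unfolding t_def by linarith+
  have m_eq: "real m / real n = 4 * ln (real n) / ratio"
    using nm n ratio_ge ln_n by (simp add: ratio_def field_simps)
  \<comment> \<open>As \<open>m / n = 4 * ln n / z ^ 2\<close>, the inequality
    \<open>(z - 2) ^ 2 \<ge> 0\<close> brings the exponent of the moment factor down to
    \<open>ln n\<close>.\<close>
  have "4 * (z - 1) \<le> z\<^sup>2" using sum_power2_ge_zero[of "z - 2" 0] by (simp add: power2_eq_square algebra_simps)
  then have zz: "4 * (z - 1) / ratio \<le> 1" using ratio_ge z2 by simp
  have "real m * (z - 1) / real n = ln (real n) * (4 * (z - 1) / ratio)"
  proof -
    have "real m * (z - 1) / real n = real m / real n * (z - 1)" by simp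
    then show ?thesis unfolding m_eq by simp
  qed
  also have "\<dots> \<le> ln (real n) * 1" using zz ln_n by (intro mult_left_mono) auto
  finally have 1: "exp (real m * (z - 1) / real n) \<le> real n"
    using n by (metis exp_le_cancel_iff exp_ln mult.right_neutral of_nat_0_less_iff n0)
  have "exp (K * ln ratio) = z powr (2 * K)"
    using z ln_realpow[of z 2] by (simp add: powr_def mult_ac flip: z2)
  also have "\<dots> \<le> z powr real t" using z t by (intro powr_mono) auto
  also have "\<dots> = z ^ t" using z by (simp add: powr_realpow)
  finally have 2: "exp (K * ln ratio) \<le> z ^ t" .
  \<comment> \<open>\<open>K * ln ratio\<close> is split into halves: one is at least
    \<open>5 * ln n\<close> by the assumption on \<open>K\<close>, the other at least
    \<open>K / 2\<close> because \<open>ln ratio \<ge> ln 4 \<ge> 1\<close>.\<close>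
  have "exp (5 * ln (real n) + K / 2) \<le> exp (K * ln ratio)"
  proof -
    have "ln 4 \<le> ln ratio" using ratio_ge by simp
    moreover have "ln 4 = 2 * ln (2::real)" using ln_realpow[of 2 2] by simp
    ultimately have "1 \<le> ln ratio" using ln2_ge_two_thirds by simp
    then have "K * 1 \<le> K * ln ratio" using K_ge by (intro mult_left_mono) auto
    then show ?thesis using K_ln_ratio by simp
  qed
  moreover have "exp (5 * ln (real n) + K / 2) = real n ^ 5 * exp (K / 2)"
    using n0 by (simp add: exp_add exp_of_nat_mult[of 5, simplified])
  ultimately have 3: "real n ^ 5 * exp (K / 2) \<le> z ^ t" using 2 by linarith
  have "measure_pmf.prob (multinomial_bin_cardinalities n m) {v. 2 * K + 1 < real (length v)}
     \<le> measure_pmf.prob (multinomial_bin_cardinalities n m) {v. t < length v}"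
    using t by (intro measure_pmf.finite_measure_mono) auto
  also have "\<dots> \<le> real n * (exp (real m * (z - 1) / real n) / z ^ t)"
    using n0 z by (intro prob_length_bin_cardinalities) auto
  also have "\<dots> \<le> real n * (real n / (real n ^ 5 * exp (K / 2)))"
    using 1 3 n0 z by (intro mult_left_mono frac_le) auto
  also have "\<dots> = exp (- K / 2) / real n ^ 3"
    using n0 by (simp add: exp_minus field_simps power_numeral_reduce)
  finally show ?thesis .
qed

lemma prob_short:
  "1 - exp (- (1 / 4) * K powr (1 / 5))
    \<le> measure_pmf.prob (multinomial_bin_cardinalities n m) {v. real (length v) \<le> 2 * K + 1}"
proof -
  have "K powr (1 / 5) \<le> K powr 1" using K_ge by (intro powr_mono) auto
  then have "K powr (1 / 5) \<le> K" using K_ge by simp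
  then have "exp (- K / 2) \<le> exp (- (1 / 4) * K powr (1 / 5))" using K_ge by simp
  moreover have "exp (- K / 2) / real n ^ 3 \<le> exp (- K / 2)"
    using n by (simp add: field_simps mult_le_cancel_left1)
  moreover have "measure_pmf.prob (multinomial_bin_cardinalities n m) {v. real (length v) \<le> 2 * K + 1}
    = 1 - measure_pmf.prob (multinomial_bin_cardinalities n m) {v. 2 * K + 1 < real (length v)}"
    by (subst measure_pmf.prob_compl[symmetric]) (auto intro!: arg_cong[of _ _ "measure _"])
  ultimately show ?thesis using prob_long by linarith
qed

text \<open>On the exceptional event the length is at most \<open>m + 1 \<le> n ^ 3\<close>, which
  cancels the factor \<open>1 / n ^ 3\<close> of \<open>prob_long\<close>. The resulting
  \<open>2 * K + 1 + 1\<close> is at most \<open>3 * K\<close> by \<open>K_ge\<close>.\<close>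

lemma expected_length:
  "(\<integral>\<^sup>+ v. ennreal (real (length v)) \<partial>measure_pmf (multinomial_bin_cardinalities n m)) \<le> ennreal (3 * K)"
proof -
  let ?M = "multinomial_bin_cardinalities n m"
  let ?A = "{v. 2 * K + 1 < real (length v)}"
  have n0: "n > 0" using n by simp
  have "(\<integral>\<^sup>+ v. ennreal (real (length v)) \<partial>measure_pmf ?M)
    \<le> (\<integral>\<^sup>+ v. ennreal (2 * K + 1) + ennreal (real (Suc m)) * indicator ?A v \<partial>measure_pmf ?M)"
  proof (rule nn_integral_mono_AE, rule AE_pmfI)
    fix v assume v: "v \<in> set_pmf ?M"
    show "ennreal (real (length v)) \<le> ennreal (2 * K + 1) + ennreal (real (Suc m)) * indicator ?A v"
    proof (cases "v \<in> ?A")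
      case True
      have "ennreal (real (length v)) \<le> ennreal (real (Suc m))"
        using length_multinomial_bin_cardinalities[OF n0 v] by (intro ennreal_leI) simp
      also have "\<dots> \<le> ennreal (2 * K + 1) + ennreal (real (Suc m))" by simp
      finally show ?thesis using True by simp
    next
      case False
      then show ?thesis by (simp add: ennreal_leI)
    qed
  qed
  also have "\<dots> = ennreal (2 * K + 1) + ennreal (real (Suc m)) * emeasure (measure_pmf ?M) ?A"
    by (simp add: nn_integral_add nn_integral_cmult)
  also have "\<dots> = ennreal (2 * K + 1 + real (Suc m) * measure_pmf.prob ?M ?A)"
    using K_ge by (simp add: measure_pmf.emeasure_eq_measure ennreal_mult'' ennreal_plus flip: ennreal_mult')
  also have "\<dots> \<le> ennreal (3 * K)"
  proof (rule ennreal_leI)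
    have "ln (real n) \<le> real n" using n by (simp add: ln_bound)
    then have "real m \<le> real n * real n" using m_le mult_left_mono[of "ln (real n)" "real n" "real n"] by linarith
    moreover have "real n * real n * 2 \<le> real n * real n * real n" using n by (intro mult_left_mono) auto
    moreover have "1 * 1 \<le> real n * real n" using n by (intro mult_mono) auto
    ultimately have "real (Suc m) \<le> real n ^ 3" by (simp add: power3_eq_cube)
    moreover have "measure_pmf.prob ?M ?A \<le> 1 / real n ^ 3"
    proof -
      have "exp (- K / 2) / real n ^ 3 \<le> 1 / real n ^ 3"
        using K_ge by (intro divide_right_mono) auto
      then show ?thesis using prob_long by linarith
    qed
    ultimately have "real (Suc m) * measure_pmf.prob ?M ?A \<le> real n ^ 3 * (1 / real n ^ 3)"
      by (intro mult_mono) auto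
    then show "2 * K + 1 + real (Suc m) * measure_pmf.prob ?M ?A \<le> 3 * K"
      using K_ge n0 by simp
  qed
  finally show ?thesis .
qed

end

section \<open>Arithmetic terms\<close>

abbreviation add :: "expr \<Rightarrow> expr \<Rightarrow> expr" where "add \<equiv> Op2 Add"
abbreviation sub :: "expr \<Rightarrow> expr \<Rightarrow> expr" where "sub \<equiv> Op2 Sub"
abbreviation mul :: "expr \<Rightarrow> expr \<Rightarrow> expr" where "mul \<equiv> Op2 Mul"

definition pow :: "expr \<Rightarrow> expr \<Rightarrow> expr" where
  "pow a b = Op2 Pow a b"

definition idiv :: "expr \<Rightarrow> expr \<Rightarrow> expr" where
  "idiv a b = Op1 Trunc (Op2 Div a b)"

definition imod :: "expr \<Rightarrow> expr \<Rightarrow> expr" where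
  "imod a b = sub a (mul b (idiv a b))"

text \<open>\<open>Let\<close> shares \<open>x\<close> in the notation only and the compiled code
  repeats it; the code still has a fixed length independent of the input.\<close>

definition binom :: "expr \<Rightarrow> expr \<Rightarrow> expr" where
  "binom a b = (let x = pow (Num 2) (add a (Num 1))
     in imod (idiv (pow (add (Num 1) x) a) (pow x b)) x)"

definition geom :: "expr \<Rightarrow> expr \<Rightarrow> expr" where
  "geom x k = idiv (sub (pow x k) (Num 1)) (sub x (Num 1))"

definition gcd_expr :: "expr \<Rightarrow> expr \<Rightarrow> expr" where
  "gcd_expr a b = (let x = add (add a b) (Num 2)
     in sub (imod (idiv (mul (geom (pow x a) (add b (Num 1))) (geom (pow x b) (add a (Num 1))))
          (pow x (mul a b))) x) (Num 1))"

definition val2 :: "expr \<Rightarrow> expr \<Rightarrow> expr" where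
  "val2 a k = Op2 Div (Op1 Ln (gcd_expr a (pow (Num 2) k))) (Op1 Ln (Num 2))"

text \<open>The base \<open>(a + 2) ^ (a + 3)\<close> exceeds \<open>a ^ 2 * (fact a + 1)\<close>,
  as \<open>fact_eq_div_binomial\<close> demands.\<close>

definition fact_expr :: "expr \<Rightarrow> expr" where
  "fact_expr a = (let x = pow (add a (Num 2)) (add a (Num 3)) in idiv (pow x a) (binom x a))"

lemma vars_below_macros [simp]:
  "vars_below d (pow a b) \<longleftrightarrow> vars_below d a \<and> vars_below d b"
  "vars_below d (idiv a b) \<longleftrightarrow> vars_below d a \<and> vars_below d b"
  "vars_below d (imod a b) \<longleftrightarrow> vars_below d a \<and> vars_below d b"
  "vars_below d (binom a b) \<longleftrightarrow> vars_below d a \<and> vars_below d b"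
  "vars_below d (geom a b) \<longleftrightarrow> vars_below d a \<and> vars_below d b"
  "vars_below d (gcd_expr a b) \<longleftrightarrow> vars_below d a \<and> vars_below d b"
  "vars_below d (val2 a b) \<longleftrightarrow> vars_below d a \<and> vars_below d b"
  "vars_below d (fact_expr a) \<longleftrightarrow> vars_below d a"
  by (auto simp: pow_def idiv_def imod_def binom_def geom_def gcd_expr_def val2_def fact_expr_def Let_def)

lemma val_numerals: "val \<rho> (Num 0) = real 0" "val \<rho> (Num 1) = real 1"
  "val \<rho> (Num (numeral x)) = real (numeral x)"
  by simp_all

lemma val_add: "val \<rho> a = real A \<Longrightarrow> val \<rho> b = real B \<Longrightarrow> val \<rho> (add a b) = real (A + B)"
  by simp

lemma val_sub: "val \<rho> a = real A \<Longrightarrow> val \<rho> b = real B \<Longrightarrow> B \<le> A \<Longrightarrow> val \<rho> (sub a b) = real (A - B)"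
  by (simp add: of_nat_diff)

lemma val_mul: "val \<rho> a = real A \<Longrightarrow> val \<rho> b = real B \<Longrightarrow> val \<rho> (mul a b) = real (A * B)"
  by simp

text \<open>Positivity keeps away from base 0, where \<open>powr\<close> gives 0 even for exponent
  0.\<close>

lemma val_pow: "val \<rho> a = real A \<Longrightarrow> val \<rho> b = real B \<Longrightarrow> 0 < A \<Longrightarrow> val \<rho> (pow a b) = real (A ^ B)"
  by (simp add: pow_def powr_realpow)

lemma val_idiv: "val \<rho> a = real A \<Longrightarrow> val \<rho> b = real B \<Longrightarrow> val \<rho> (idiv a b) = real (A div B)"
  by (simp add: idiv_def floor_divide_of_nat_eq)

lemma val_imod: "val \<rho> a = real A \<Longrightarrow> val \<rho> b = real B \<Longrightarrow> val \<rho> (imod a b) = real (A mod B)"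
  unfolding imod_def
  by (subst minus_mult_div_eq_mod[symmetric])
     (intro val_sub val_mul val_idiv; simp)

lemmas val_nat_intros = val_add val_mul val_idiv val_imod val_numerals

lemma val_binom:
  assumes "val \<rho> a = real A" "val \<rho> b = real B"
  shows "val \<rho> (binom a b) = real (A choose B)"
proof -
  have x: "val \<rho> (pow (Num 2) (add a (Num 1))) = real (2 ^ (A + 1))"
    by (intro val_pow val_nat_intros assms) simp
  show ?thesis
    unfolding binom_def Let_def binomial_digit[of A B, symmetric] Suc_eq_plus1
    by (intro val_imod val_idiv val_pow val_add val_numerals x assms) simp_all
qed

lemma val_geom:
  assumes "val \<rho> x = real X" "val \<rho> k = real K" "1 < X"
  shows "val \<rho> (geom x k) = real (\<Sum>i<K. X ^ i)"
  unfolding geom_def geometric_sum_nat[OF assms(3)]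
  using assms by (intro val_idiv val_sub val_pow val_numerals assms) (simp_all add: Suc_le_eq)

lemma val_gcd:
  assumes "val \<rho> a = real A" "val \<rho> b = real B" "0 < A" "0 < B"
  shows "val \<rho> (gcd_expr a b) = real (gcd A B)"
proof -
  define X where "X = A + B + 2"
  have x: "val \<rho> (add (add a b) (Num 2)) = real X"
    unfolding X_def by (intro val_add val_numerals assms)
  have pow_gt: "1 < X ^ A" "1 < X ^ B" using assms one_less_power[of X A] one_less_power[of X B] by (simp_all add: X_def)
  have "gcd A B = ((\<Sum>s<B + 1. (X ^ A) ^ s) * (\<Sum>t<A + 1. (X ^ B) ^ t)) div X ^ (A * B) mod X - 1"
    unfolding Suc_eq_plus1[symmetric] by (subst gcd_digit) (use assms in \<open>simp_all add: X_def\<close>)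
  moreover have "1 \<le> ((\<Sum>s<B + 1. (X ^ A) ^ s) * (\<Sum>t<A + 1. (X ^ B) ^ t)) div X ^ (A * B) mod X"
    unfolding Suc_eq_plus1[symmetric] by (subst gcd_digit) (use assms in \<open>simp_all add: X_def\<close>)
  ultimately show ?thesis
    unfolding gcd_expr_def Let_def
    by (simp only:) (intro val_sub val_imod val_idiv val_mul val_geom val_pow val_add val_numerals x assms pow_gt;
      simp add: X_def)
qed

lemma val_val2:
  assumes "val \<rho> a = real A" "val \<rho> k = real K" "0 < A" "multiplicity 2 A \<le> K"
  shows "val \<rho> (val2 a k) = real (multiplicity 2 A)"
proof -
  have "val \<rho> (gcd_expr a (pow (Num 2) k)) = real (gcd A (2 ^ K))"
    by (intro val_gcd val_pow val_numerals assms) (use assms in simp_all)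
  also have "\<dots> = 2 ^ multiplicity 2 A"
    using gcd_2_power[OF assms(3,4)] by simp
  finally show ?thesis
    by (simp add: val2_def ln_realpow)
qed

lemma val_fact:
  assumes "val \<rho> a = real A"
  shows "val \<rho> (fact_expr a) = real (fact A)"
proof -
  define B where "B = (A + 2) ^ (A + 3)"
  have B: "val \<rho> (pow (add a (Num 2)) (add a (Num 3))) = real B"
    unfolding B_def by (intro val_pow val_add val_numerals assms) simp
  have "A\<^sup>2 * (fact A + 1) < B"
  proof -
    define a where "a = A + 2"
    have "fact A \<le> a ^ A"
      using fact_le_power[of A, where 'a = nat] power_mono[of A a A] by (simp add: a_def)
    moreover have "1 \<le> a ^ A" by (rule one_le_power) (simp add: a_def)
    ultimately have "fact A + 1 \<le> 2 * a ^ A" by linarith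
    also have "\<dots> \<le> a * a ^ A" by (intro mult_right_mono) (simp_all add: a_def)
    finally have "A\<^sup>2 * (fact A + 1) \<le> A\<^sup>2 * (a * a ^ A)" by (rule mult_left_mono) simp
    also have "\<dots> < a\<^sup>2 * (a * a ^ A)"
      by (intro mult_strict_right_mono power_strict_mono) (simp_all add: a_def)
    also have "\<dots> = B" unfolding B_def a_def[symmetric] by (simp add: power_add power2_eq_square power3_eq_cube)
    finally show ?thesis .
  qed
  then have "fact A = B ^ A div (B choose A)"
    by (simp add: fact_eq_div_binomial)
  moreover have "0 < B" by (simp add: B_def)
  ultimately show ?thesis
    unfolding fact_expr_def Let_def
    by (simp only:) (intro val_idiv val_pow val_binom B assms)
qed

text \<open>Multiplication by \<open>fact m * B ^ m\<close> turns the terms up to \<open>m\<close>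
  of the exponential series at \<open>1 / B\<close> into an integer. The Lagrange remainder becomes
  \<open>exp t / ((m + 1) * B)\<close>, at most \<open>3 / 4\<close>, so the floor removes
  it.\<close>

lemma floor_exp_eq_level_poly:
  assumes "4 \<le> B"
  shows "\<lfloor>fact m * real B ^ m * exp (1 / real B)\<rfloor> = int (poly (level_poly m 0) B)"
proof -
  have B: "real B > 0" using assms by simp
  obtain t where t: "\<bar>t\<bar> \<le> \<bar>1 / real B\<bar>"
    "exp (1 / real B) = (\<Sum>i<Suc m. (1 / real B) ^ i / fact i) + exp t / fact (Suc m) * (1 / real B) ^ Suc m"
    using Maclaurin_exp_le[of "1 / real B" "Suc m"] by blast
  have "\<bar>1 / real B\<bar> \<le> 1" using assms by simp
  then have "t \<le> 1" using t(1) by linarith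
  then have exp_t: "exp t \<le> 3" using exp_le by (meson exp_le_cancel_iff order_trans)
  define r where "r = exp t / (real (Suc m) * real B)"
  have r0: "0 \<le> r" by (simp add: r_def)
  have "r \<le> 3 / (1 * 4)"
    unfolding r_def using exp_t assms by (intro frac_le mult_mono) auto
  then have r1: "r < 1" by simp
  have "fact m * real B ^ m * (exp t / fact (Suc m) * (1 / real B) ^ Suc m) = r"
    using B by (simp add: r_def power_divide del: of_nat_Suc)
  moreover have "fact m * real B ^ m * (\<Sum>i<Suc m. (1 / real B) ^ i / fact i)
      = real (poly (level_poly m 0) B)"
  proof -
    have "real (poly (level_poly m 0) B) = (\<Sum>i<Suc m. real (inv_fact_coeff m i) * real B ^ (m - i))"
      by (simp add: level_poly_def poly_sum poly_monom atLeast0AtMost lessThan_Suc_atMost)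
    also have "\<dots> = (\<Sum>i<Suc m. fact m * real B ^ m * ((1 / real B) ^ i / fact i))"
    proof (rule sum.cong)
      fix i assume "i \<in> {..<Suc m}"
      then show "real (inv_fact_coeff m i) * real B ^ (m - i) = fact m * real B ^ m * ((1 / real B) ^ i / fact i)"
        using B by (simp add: real_inv_fact_coeff power_diff power_divide)
    qed simp
    finally show ?thesis by (simp add: sum_distrib_left del: sum.lessThan_Suc)
  qed
  ultimately have "fact m * real B ^ m * exp (1 / real B) = real (poly (level_poly m 0) B) + r"
    unfolding t(2) by (simp only: distrib_left)
  then show ?thesis using r0 r1 by linarith
qed

text \<open>With \<open>G\<close> and \<open>F\<close> for the packed \<open>g\<close> and
  \<open>f\<close>, the suffix sums satisfy \<open>G * Y = (Y - 1) * F + f 0\<close>, so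
  \<open>f 0\<close> is the remainder of the division; hence the bound on it.\<close>

lemma packed_tails:
  fixes f g :: "nat \<Rightarrow> nat"
  assumes "\<And>k. k < N \<Longrightarrow> f k = g k + f (Suc k)" "f N = 0" "f 0 < Y - 1"
  shows "(\<Sum>k<N. g k * Y ^ k) * Y div (Y - 1) = (\<Sum>k<N. f k * Y ^ k)"
proof -
  obtain y where y: "Y = Suc y" using assms(3) by (cases Y) auto
  have "y * (\<Sum>k<M. f k * Y ^ k) + f 0 = (\<Sum>k<M. g k * Y ^ k) * Y + f M * Y ^ M" if "M \<le> N" for M
    using that
  proof (induction M)
    case (Suc M)
    have f: "f M = g M + f (Suc M)" using assms(1)[of M] Suc.prems by simp
    have IH: "y * (\<Sum>k<M. f k * Y ^ k) + f 0 = (\<Sum>k<M. g k * Y ^ k) * Y + f M * Y ^ M"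
      using Suc by simp
    have "y * (\<Sum>k<Suc M. f k * Y ^ k) + f 0 = (y * (\<Sum>k<M. f k * Y ^ k) + f 0) + y * (f M * Y ^ M)"
      by (simp add: algebra_simps)
    also have "\<dots> = (\<Sum>k<M. g k * Y ^ k) * Y + f M * Y ^ M * Suc y"
      unfolding IH by (simp add: algebra_simps)
    also have "\<dots> = (\<Sum>k<M. g k * Y ^ k) * Y + (g M + f (Suc M)) * Y ^ M * Y"
      unfolding y[symmetric] f ..
    also have "\<dots> = (\<Sum>k<Suc M. g k * Y ^ k) * Y + f (Suc M) * Y ^ Suc M"
      by (simp add: algebra_simps)
    finally show ?case .
  qed simp
  from this[of N] have "(\<Sum>k<N. g k * Y ^ k) * Y = f 0 + y * (\<Sum>k<N. f k * Y ^ k)"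
    using assms(2) by simp
  then show ?thesis using assms(3) by (simp add: y)
qed

section \<open>Packed weights of one level and the selection of an entry\<close>

locale packing =
  fixes n m :: nat
begin

text \<open>All weights are at most \<open>w\<close>, a comparison of two of them sets or clears the bit of value \<open>h\<close>
  of a base \<open>Y\<close> digit, and \<open>B\<close> exceeds every packed sequence of \<open>n + 1\<close> weights.\<close>

definition w :: nat where "w = (Suc m * fact m) ^ n"
definition h :: nat where "h = 2 ^ w"
definition Y :: nat where "Y = 4 * h"
definition B :: nat where "B = Y ^ (n + 1)"

lemma w_less_h: "w < h"
  by (simp add: h_def)

lemma h_pos: "0 < h"
  by (simp add: h_def)

lemma Y_ge: "4 \<le> Y"
  using h_pos by (simp add: Y_def)

lemma B_ge: "4 \<le> B"
proof -
  have "Y ^ 1 \<le> Y ^ (n + 1)" using Y_ge by (intro power_increasing) auto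
  then show ?thesis using Y_ge unfolding B_def power_one_right by linarith
qed

lemma tail_less: "j \<le> m \<Longrightarrow> p \<le> n \<Longrightarrow> level_tail m p s j k < h"
  using tail_le[of j m p n s k] w_less_h by (simp add: w_def del: mult_Suc)

text \<open>Kronecker substitution in two variables: base \<open>B\<close> separates the exponent
  \<open>s\<close>, and inside that digit base \<open>Y\<close> separates \<open>k\<close>, which is
  marked by the factor \<open>Y\<close> in front of \<open>e\<close>.\<close>

lemma packed_parts:
  assumes "j \<le> m" "p \<le> n"
  defines "e \<equiv> inv_fact_coeff m j * B ^ (m - j)"
  shows "(Y * e + poly (level_poly m (Suc j)) B) ^ p div B ^ s mod B
    = (\<Sum>k<Suc p. level_part m p s j k * Y ^ k)"
proof -
  define P where "P = (monom (Y * inv_fact_coeff m j) (m - j) + level_poly m (Suc j)) ^ p"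
  have "(Y * e + poly (level_poly m (Suc j)) B) ^ p = poly P B"
    by (simp add: P_def e_def poly_monom mult_ac)
  moreover have "coeff P i < B" for i
  proof -
    \<comment> \<open>No overflow in base \<open>B\<close>: the value at 1 is at most
      \<open>Y ^ n * w\<close>, and \<open>w < Y\<close> makes this less than
      \<open>Y ^ (n + 1) = B\<close>.\<close>
    have "coeff P i \<le> poly P 1" by (rule coeff_le_poly_1)
    also have "poly P 1 = (Y * inv_fact_coeff m j + poly (level_poly m (Suc j)) 1) ^ p"
      by (simp add: P_def poly_monom)
    also have "\<dots> \<le> (Y * poly (level_poly m j) 1) ^ p"
      using Y_ge assms by (intro power_mono) (simp_all add: level_poly_step[of j m] poly_monom distrib_left)
    also have "\<dots> \<le> (Y * (Suc m * fact m)) ^ p"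
      by (intro power_mono mult_left_mono level_poly_at_1_le) auto
    also have "\<dots> = Y ^ p * (Suc m * fact m) ^ p" by (rule power_mult_distrib)
    also have "\<dots> \<le> Y ^ n * (Suc m * fact m) ^ n"
      using Y_ge assms by (intro mult_mono power_increasing) (auto simp: Suc_le_eq simp del: mult_Suc)
    also have "\<dots> < Y ^ n * Y"
    proof -
      have "(Suc m * fact m) ^ n < Y"
        using w_less_h by (simp add: w_def Y_def del: mult_Suc)
      then show ?thesis using Y_ge by (simp del: mult_Suc)
    qed
    finally show ?thesis by (simp add: B_def mult.commute)
  qed
  ultimately have "(Y * e + poly (level_poly m (Suc j)) B) ^ p div B ^ s mod B = coeff P s"
    using digit_poly[of P B s] by simp
  also have "\<dots> = (\<Sum>k<Suc p. level_part m p s j k * Y ^ k)"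
    unfolding P_def coeff_binomial_power level_part_def level_total_def lessThan_Suc_atMost
    by (intro sum.cong refl)
  finally show ?thesis .
qed

lemma packed_level_tails:
  assumes "j \<le> m" "p \<le> n"
  shows "(\<Sum>k<Suc p. level_part m p s j k * Y ^ k) * Y div (Y - 1) = (\<Sum>k<Suc p. level_tail m p s j k * Y ^ k)"
proof (rule packed_tails)
  show "level_tail m p s j k = level_part m p s j k + level_tail m p s j (Suc k)" if "k < Suc p" for k
    using that tail_step[of k p m s j] by simp
  show "level_tail m p s j (Suc p) = 0" by (simp add: tail_eq_0)
  show "level_tail m p s j 0 < Y - 1" using tail_less[OF assms, of s 0] by (simp add: Y_def)
qed

lemma tail_digit:
  assumes "j \<le> m" "p \<le> n"
  shows "(\<Sum>k<Suc p. level_tail m p s j k * Y ^ k) div Y ^ k mod Y = level_tail m p s j k"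
proof -
  have "level_tail m p s j i < Y" for i
    using tail_less[OF assms, of s i] by (simp add: Y_def)
  then show ?thesis
    using digit_sum[of "level_tail m p s j" Y "Suc p" k] by (auto simp: tail_eq_0 simp del: sum.lessThan_Suc)
qed

text \<open>Tails are integers, so exceeding \<open>u\<close> times the total means exceeding its
  floor \<open>r\<close>. Adding \<open>h - 1 - r\<close> to every digit turns this into reaching
  \<open>h\<close>, and adding \<open>h\<close> once more triggers the carry; together this is
  \<open>2 * h - 1 - r\<close> times the repunit \<open>R\<close>.\<close>

lemma pick_by_carries:
  assumes "j \<le> m" "p \<le> n" "0 \<le> u" "u < 1" "0 < level_tail m p s j 0"
  defines "r \<equiv> nat \<lfloor>u * real (level_tail m p s j 0)\<rfloor>"
    and "R \<equiv> \<Sum>k<Suc p. Y ^ k" and "P \<equiv> \<Sum>k<Suc p. level_tail m p s j k * Y ^ k"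
  shows "r < h" and "multiplicity 2 ((P + (2 * h - 1 - r) * R) choose (h * R)) = Suc (pick m p s j u)"
    and "h * R \<le> P + (2 * h - 1 - r) * R"
proof -
  define x where "x = u * real (level_tail m p s j 0)"
  have x: "0 \<le> x" "x < real (level_tail m p s j 0)" using assms by (simp_all add: x_def)
  have r_iff: "r < k \<longleftrightarrow> x < real k" for k
    using x unfolding r_def x_def[symmetric] by linarith
  have "r < level_tail m p s j 0" using x r_iff by simp
  then show r: "r < h" using tail_less[OF assms(1,2), of s 0] by simp
  define t where "t k = level_tail m p s j k + (h - 1 - r)" for k
  have t: "t k < 2 * 2 ^ w" for k
    using tail_less[OF assms(1,2), of s k] r by (simp add: t_def h_def)
  have "(\<Sum>k<Suc p. t k * Y ^ k) = P + (h - 1 - r) * R"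
    by (simp add: t_def P_def R_def sum.distrib sum_distrib_left distrib_right del: sum.lessThan_Suc)
  moreover have "P + (h - 1 - r) * R + h * R = P + (2 * h - 1 - r) * R"
  proof -
    have "2 * h - 1 - r = (h - 1 - r) + h" using r by simp
    then show ?thesis by (simp add: distrib_right)
  qed
  ultimately have sum: "(\<Sum>k<Suc p. t k * Y ^ k) + h * R = P + (2 * h - 1 - r) * R" by simp
  then show "h * R \<le> P + (2 * h - 1 - r) * R" by linarith
  have "multiplicity 2 ((P + (2 * h - 1 - r) * R) choose (h * R)) = card {k. k < Suc p \<and> 2 ^ w \<le> t k}"
    using multiplicity_2_packed_carries[of t w "Suc p", OF t] sum
    unfolding Y_def R_def h_def by simp
  \<comment> \<open>Digit 0 holds the total, which always exceeds the threshold; it accounts for the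
    \<open>Suc\<close>.\<close>
  also have "{k. k < Suc p \<and> 2 ^ w \<le> t k} = insert 0 {k. 1 \<le> k \<and> k \<le> p \<and> x < real (level_tail m p s j k)}"
  proof -
    have "2 ^ w \<le> t k \<longleftrightarrow> x < real (level_tail m p s j k)" for k
      using r r_iff[of "level_tail m p s j k"] by (auto simp: t_def h_def[symmetric])
    then show ?thesis using x by (auto simp: Suc_le_eq)
  qed
  also have "card \<dots> = Suc (pick m p s j u)"
    by (subst card_insert_disjoint) (auto simp: pick_def x_def)
  finally show "multiplicity 2 ((P + (2 * h - 1 - r) * R) choose (h * R)) = Suc (pick m p s j u)" .
qed

end

section \<open>The program\<close>

text \<open>Register usage: 0 the level \<open>j\<close>, 1 the number \<open>m\<close> of balls, 3 and 4 the numbers \<open>p\<close> and \<open>s\<close>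
  of the state, 5 \<open>m! / j!\<close>, 6 the value at \<open>B\<close> of the level polynomial, 7 the number \<open>u\<close>, 8 \<open>Y\<close>,
  9 \<open>B\<close>, 10 \<open>n\<close>, 11 zero, 12 \<open>h\<close>, 13 to 22 temporary values.\<close>

definition init_assigns :: "(nat \<times> expr) list" where
  "init_assigns = [
    (10, Var 0),
    (3, Var 0),
    (7, sub (Var 7) (Op1 Trunc (Var 7))),
    (4, sub (mul (Var 1) (Var 10)) (Var 1)),
    (5, fact_expr (Var 1)),
    (12, pow (Num 2) (pow (mul (add (Var 1) (Num 1)) (Var 5)) (Var 10))),
    (8, mul (Num 4) (Var 12)),
    (9, pow (Var 8) (add (Var 10) (Num 1))),
    (6, Op1 Trunc (mul (mul (Var 5) (pow (Var 9) (Var 1))) (Op1 Exp (Op2 Div (Num 1) (Var 9))))),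
    (0, Num 0)]"

text \<open>Register 22 packs the parts and 15 the tails; 16 is the total, read as digit 0; 17 and
  18 are \<open>r\<close> and \<open>R\<close> of \<open>pick_by_carries\<close>. The subtraction at
  the end of 19 removes the carry of digit 0, and the number \<open>p + 1\<close> of digits bounds
  the valuation.\<close>

definition pick_assigns :: "(nat \<times> expr) list" where
  "pick_assigns = [
    (13, mul (Var 5) (pow (Var 9) (sub (Var 1) (Var 0)))),
    (14, sub (Var 6) (Var 13)),
    (22, imod (idiv (pow (add (mul (Var 8) (Var 13)) (Var 14)) (Var 3)) (pow (Var 9) (Var 4))) (Var 9)),
    (15, idiv (mul (Var 22) (Var 8)) (sub (Var 8) (Num 1))),
    (16, imod (Var 15) (Var 8)),
    (17, Op1 Trunc (mul (Var 7) (Var 16))),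
    (18, geom (Var 8) (add (Var 3) (Num 1))),
    (19, sub (val2 (binom (add (Var 15) (mul (sub (sub (mul (Num 2) (Var 12)) (Num 1)) (Var 17)) (Var 18)))
                  (mul (Var 12) (Var 18)))
               (add (Var 3) (Num 1))) (Num 1)),
    (20, imod (idiv (Var 15) (pow (Var 8) (Var 19))) (Var 8)),
    (21, imod (idiv (Var 15) (pow (Var 8) (add (Var 19) (Num 1)))) (Var 8))]"

text \<open>The order matters: register 4 is computed with the old level, while register 5 is
  divided by the new one.\<close>

definition next_assigns :: "(nat \<times> expr) list" where
  "next_assigns = [
    (7, Op2 Div (sub (mul (Var 7) (Var 16)) (Var 21)) (sub (Var 20) (Var 21))),
    (3, sub (Var 3) (Var 19)),
    (4, sub (Var 4) (mul (Var 19) (sub (Var 1) (Var 0)))),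
    (6, Var 14),
    (0, add (Var 0) (Num 1)),
    (5, idiv (Var 5) (Var 0))]"

definition init_code :: program where
  "init_code = Uniform 7 # assign_code 30 init_assigns"

definition body_code :: program where
  "body_code = assign_code 30 pick_assigns @ [Store 0 19] @ assign_code 30 next_assigns"

text \<open>Register 11 stays 0, so \<open>JumpLe 3 11\<close> leaves when no bins remain and
  \<open>JumpLe 11 11\<close> is an unconditional jump back. At exit the level counter in register 0
  equals the length of the output, as the output convention requires.\<close>

definition sampler :: program where
  "sampler = init_code @ [JumpLe 3 11 (length init_code + length body_code + 2)] @ body_code
     @ [JumpLe 11 11 (length init_code)]"

lemma init_assigns_wf: "\<forall>(x, e)\<in>set init_assigns. x < 30 \<and> vars_below 30 e"
  by (simp add: init_assigns_def)

lemma pick_assigns_wf: "\<forall>(x, e)\<in>set pick_assigns. x < 30 \<and> vars_below 30 e"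
  by (simp add: pick_assigns_def)

lemma next_assigns_wf: "\<forall>(x, e)\<in>set next_assigns. x < 30 \<and> vars_below 30 e"
  by (simp add: next_assigns_def)

lemma straight_body: "\<forall>i\<in>set body_code. straight i"
  using straight_assign_code by (auto simp: body_code_def)

lemma straight_init: "\<forall>i\<in>set init_code. straight i"
  using straight_assign_code by (auto simp: init_code_def)

text \<open>Covers \<open>j = m\<close> as well, so the loop invariant survives the step beyond the
  last level.\<close>

lemma inv_fact_coeff_Suc: "inv_fact_coeff m (Suc j) = inv_fact_coeff m j div Suc j"
  unfolding inv_fact_coeff_def fact_Suc of_nat_id mult.commute[of "Suc j"] by (rule div_mult2_eq)

section \<open>Correctness of the machine run\<close>

context packing
begin

definition state :: "nat \<Rightarrow> nat \<Rightarrow> nat \<Rightarrow> real \<Rightarrow> (nat \<Rightarrow> real) \<Rightarrow> bool" where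
  "state p s j u \<rho> \<longleftrightarrow> \<rho> 0 = real j \<and> \<rho> 1 = real m \<and> \<rho> 3 = real p \<and> \<rho> 4 = real s
    \<and> \<rho> 5 = real (inv_fact_coeff m j) \<and> \<rho> 6 = real (poly (level_poly m j) B) \<and> \<rho> 7 = u
    \<and> \<rho> 8 = real Y \<and> \<rho> 9 = real B \<and> \<rho> 11 = 0 \<and> \<rho> 12 = real h"

lemma state_cong: "state p s j u \<rho> \<Longrightarrow> (\<And>i. i < 30 \<Longrightarrow> \<rho>' i = \<rho> i) \<Longrightarrow> state p s j u \<rho>'"
  by (simp add: state_def)

lemma init_assigns_state:
  assumes "0 < n" and \<rho>: "\<rho> 0 = real n" "\<rho> 1 = real m" "\<rho> 11 = 0"
  shows "state n (m * n - m) 0 (frac (\<rho> 7)) (assigns init_assigns \<rho>)"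
proof -
  have v5: "val \<rho>' (fact_expr (Var 1)) = real (inv_fact_coeff m 0)" if "\<rho>' 1 = real m" for \<rho>'
    using val_fact[of \<rho>' "Var 1" m] that by (simp add: inv_fact_coeff_def)
  have v12: "val \<rho>' (pow (Num 2) (pow (mul (add (Var 1) (Num 1)) (Var 5)) (Var 10))) = real h"
    if "\<rho>' 1 = real m" "\<rho>' 5 = real (inv_fact_coeff m 0)" "\<rho>' 10 = real n" for \<rho>'
    unfolding h_def w_def Suc_eq_plus1
    by (intro val_pow val_mul val_add val_numerals) (use that in \<open>simp_all add: inv_fact_coeff_def\<close>)
  have v9: "val \<rho>' (pow (Var 8) (add (Var 10) (Num 1))) = real B"
    if "\<rho>' 8 = real Y" "\<rho>' 10 = real n" for \<rho>'
    unfolding B_def by (intro val_pow val_add val_numerals) (use that Y_ge in simp_all)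
  have v6: "val \<rho>' (pow (Var 9) (Var 1)) = real (B ^ m)" if "\<rho>' 9 = real B" "\<rho>' 1 = real m" for \<rho>'
    by (intro val_pow) (use that B_ge in simp_all)
  have fl: "of_int \<lfloor>real (inv_fact_coeff m 0) * real B ^ m * exp (1 / real B)\<rfloor> = real (poly (level_poly m 0) B)"
    using floor_exp_eq_level_poly[OF B_ge, of m] by (simp add: inv_fact_coeff_def)
  have s: "real m * real n - real m = real (m * n - m)"
    using assms(1) by (simp add: of_nat_diff)
  have frac: "\<rho> 7 - of_int \<lfloor>\<rho> 7\<rfloor> = frac (\<rho> 7)" by (simp add: frac_def)
  show ?thesis
    unfolding init_assigns_def state_def
    by (simp add: assigns_def \<rho> v5 v12 v9 v6 fl s frac Y_def del: One_nat_def)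
qed

lemma pick_assigns_state:
  assumes st: "state p s j u \<rho>" and le: "0 < p" "p \<le> n" and u: "0 \<le> u" "u < 1"
    and pos: "0 < level_total m p s j"
  defines "k \<equiv> pick m p s j u"
  shows "state p s j u (assigns pick_assigns \<rho>)"
    and "assigns pick_assigns \<rho> 14 = real (poly (level_poly m (Suc j)) B)"
    and "assigns pick_assigns \<rho> 16 = real (level_tail m p s j 0)"
    and "assigns pick_assigns \<rho> 19 = real k"
    and "assigns pick_assigns \<rho> 20 = real (level_tail m p s j k)"
    and "assigns pick_assigns \<rho> 21 = real (level_tail m p s j (Suc k))"
proof -
  have j: "j \<le> m" using level_le[OF pos le(1)] .
  have tail_pos: "0 < level_tail m p s j 0" using pos j by (simp add: tail_0)
  define e where "e = inv_fact_coeff m j * B ^ (m - j)"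
  define q where "q = poly (level_poly m (Suc j)) B"
  define P where "P = (\<Sum>k<Suc p. level_tail m p s j k * Y ^ k)"
  define P0 where "P0 = (\<Sum>k<Suc p. level_part m p s j k * Y ^ k)"
  define W where "W = level_tail m p s j 0"
  define r where "r = nat \<lfloor>u * real W\<rfloor>"
  define R where "R = (\<Sum>k<Suc p. Y ^ k)"
  have e_pos: "0 < e" using B_ge inv_fact_coeff_pos[OF j] by (simp add: e_def)
  have poly_eq: "poly (level_poly m j) B = e + q"
    using j by (simp add: level_poly_step[of j m] poly_monom e_def q_def)
  note pick = pick_by_carries[OF j le(2) u tail_pos, folded P_def R_def W_def, folded r_def, folded k_def]
  define T where "T = P + (2 * h - 1 - r) * R"
  have C_pos: "0 < (T choose (h * R))" using pick(3) by (simp add: T_def)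
  have kp: "k \<le> p" unfolding k_def by (rule pick_le)
  have r_real: "of_int \<lfloor>u * real W\<rfloor> = real r"
    using u by (simp add: r_def)
  note simps = st[unfolded state_def]
  define \<rho>1 where "\<rho>1 = \<rho>(13 := real e)"
  define \<rho>2 where "\<rho>2 = \<rho>1(14 := real q)"
  define \<rho>3 where "\<rho>3 = \<rho>2(22 := real P0)"
  define \<rho>4 where "\<rho>4 = \<rho>3(15 := real P)"
  define \<rho>5 where "\<rho>5 = \<rho>4(16 := real W)"
  define \<rho>6 where "\<rho>6 = \<rho>5(17 := real r)"
  define \<rho>7 where "\<rho>7 = \<rho>6(18 := real R)"
  define \<rho>8 where "\<rho>8 = \<rho>7(19 := real k)"
  define \<rho>9 where "\<rho>9 = \<rho>8(20 := real (level_tail m p s j k))"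
  define \<rho>10 where "\<rho>10 = \<rho>9(21 := real (level_tail m p s j (Suc k)))"
  note \<rho>_defs = \<rho>1_def \<rho>2_def \<rho>3_def \<rho>4_def \<rho>5_def \<rho>6_def \<rho>7_def \<rho>8_def \<rho>9_def \<rho>10_def
  have Vars: "\<And>i x \<rho>. \<rho> i = x \<Longrightarrow> val \<rho> (Var i) = x" by simp
  have v1: "val \<rho> (mul (Var 5) (pow (Var 9) (sub (Var 1) (Var 0)))) = real e"
    unfolding e_def by (intro val_mul val_pow val_sub Vars) (use simps j B_ge in simp_all)
  have v2: "val \<rho>1 (sub (Var 6) (Var 13)) = real q"
    using simps by (simp add: \<rho>_defs poly_eq)
  have v3: "val \<rho>2 (imod (idiv (pow (add (mul (Var 8) (Var 13)) (Var 14)) (Var 3)) (pow (Var 9) (Var 4))) (Var 9)) = real P0"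
    unfolding P0_def packed_parts[OF j le(2), symmetric] e_def[symmetric] q_def[symmetric]
    by (intro val_imod val_idiv val_mul val_pow val_add Vars) (use simps e_pos Y_ge B_ge in \<open>simp_all add: \<rho>_defs\<close>)
  have v4: "val \<rho>3 (idiv (mul (Var 22) (Var 8)) (sub (Var 8) (Num 1))) = real P"
    unfolding P_def packed_level_tails[OF j le(2), symmetric] P0_def[symmetric]
    by (intro val_idiv val_mul val_sub val_numerals Vars) (use simps Y_ge in \<open>simp_all add: \<rho>_defs\<close>)
  have "W = P mod Y" using tail_digit[OF j le(2), of s 0] by (simp add: W_def P_def)
  then have v5: "val \<rho>4 (imod (Var 15) (Var 8)) = real W"
    by (simp only:) (intro val_imod Vars; use simps in \<open>simp add: \<rho>_defs\<close>)
  have v6: "val \<rho>5 (Op1 Trunc (mul (Var 7) (Var 16))) = real r"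
    using simps r_real by (simp add: \<rho>_defs)
  have v7: "val \<rho>6 (geom (Var 8) (add (Var 3) (Num 1))) = real R"
    unfolding R_def Suc_eq_plus1
    by (intro val_geom val_add val_numerals Vars) (use simps Y_ge in \<open>simp_all add: \<rho>_defs\<close>)
  have "val \<rho>7 (val2 (binom (add (Var 15) (mul (sub (sub (mul (Num 2) (Var 12)) (Num 1)) (Var 17)) (Var 18)))
                  (mul (Var 12) (Var 18))) (add (Var 3) (Num 1))) = real (multiplicity 2 (T choose (h * R)))"
  proof (rule val_val2)
    show "val \<rho>7 (binom (add (Var 15) (mul (sub (sub (mul (Num 2) (Var 12)) (Num 1)) (Var 17)) (Var 18)))
                  (mul (Var 12) (Var 18))) = real (T choose (h * R))"
      unfolding T_def
      by (intro val_binom val_add val_mul val_sub val_numerals Vars)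
        (use simps pick(1) in \<open>simp_all add: \<rho>_defs\<close>)
    show "val \<rho>7 (add (Var 3) (Num 1)) = real (p + 1)"
      by (intro val_add val_numerals Vars) (use simps in \<open>simp_all add: \<rho>_defs\<close>)
    show "multiplicity 2 (T choose (h * R)) \<le> p + 1"
      using pick(2) kp by (simp add: T_def)
  qed (rule C_pos)
  then have v8: "val \<rho>7 (sub (val2 (binom (add (Var 15) (mul (sub (sub (mul (Num 2) (Var 12)) (Num 1)) (Var 17)) (Var 18)))
                  (mul (Var 12) (Var 18))) (add (Var 3) (Num 1))) (Num 1)) = real k"
    using pick(2) by (simp add: T_def)
  have v9: "val \<rho>8 (imod (idiv (Var 15) (pow (Var 8) (Var 19))) (Var 8)) = real (level_tail m p s j k)"
    unfolding tail_digit[OF j le(2), of s k, symmetric] P_def[symmetric]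
    by (intro val_imod val_idiv val_pow Vars) (use simps Y_ge in \<open>simp_all add: \<rho>_defs\<close>)
  have "val \<rho>9 (imod (idiv (Var 15) (pow (Var 8) (add (Var 19) (Num 1)))) (Var 8)) = real (P div Y ^ (k + 1) mod Y)"
    by (intro val_imod val_idiv val_pow val_add val_numerals Vars) (use simps Y_ge in \<open>simp_all add: \<rho>_defs\<close>)
  then have v10: "val \<rho>9 (imod (idiv (Var 15) (pow (Var 8) (add (Var 19) (Num 1)))) (Var 8)) = real (level_tail m p s j (Suc k))"
    using tail_digit[OF j le(2), of s "Suc k"] by (simp only: P_def Suc_eq_plus1[of k])
  have final: "assigns pick_assigns \<rho> = \<rho>10"
    unfolding pick_assigns_def
      assigns_Cons[OF v1] \<rho>1_def[symmetric] assigns_Cons[OF v2] \<rho>2_def[symmetric]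
      assigns_Cons[OF v3] \<rho>3_def[symmetric] assigns_Cons[OF v4] \<rho>4_def[symmetric]
      assigns_Cons[OF v5] \<rho>5_def[symmetric] assigns_Cons[OF v6] \<rho>6_def[symmetric]
      assigns_Cons[OF v7] \<rho>7_def[symmetric] assigns_Cons[OF v8] \<rho>8_def[symmetric]
      assigns_Cons[OF v9] \<rho>9_def[symmetric] assigns_Cons[OF v10] \<rho>10_def[symmetric]
    by (rule assigns_Nil)
  show "state p s j u (assigns pick_assigns \<rho>)"
    unfolding final state_def using simps by (simp add: \<rho>_defs)
  show "assigns pick_assigns \<rho> 14 = real (poly (level_poly m (Suc j)) B)"
    and "assigns pick_assigns \<rho> 16 = real (level_tail m p s j 0)"
    and "assigns pick_assigns \<rho> 19 = real k"
    and "assigns pick_assigns \<rho> 20 = real (level_tail m p s j k)"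
    and "assigns pick_assigns \<rho> 21 = real (level_tail m p s j (Suc k))"
    unfolding final by (simp_all add: \<rho>_defs q_def W_def)
qed

lemma next_assigns_state:
  assumes st: "state p s j u \<rho>" and j: "j \<le> m" and k: "k \<le> p" "k * (m - j) \<le> s"
    and \<rho>: "\<rho> 14 = real (poly (level_poly m (Suc j)) B)" "\<rho> 19 = real k"
    "\<rho> 16 = real (level_tail m p s j 0)" "\<rho> 20 = real (level_tail m p s j k)"
    "\<rho> 21 = real (level_tail m p s j (Suc k))" and pick: "pick m p s j u = k"
  shows "state (p - k) (s - k * (m - j)) (Suc j) (rescale m p s j u) (assigns next_assigns \<rho>)"
proof -
  note simps = st[unfolded state_def]
  have v5: "val \<rho>' (idiv (Var 5) (Var 0)) = real (inv_fact_coeff m (Suc j))"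
    if "\<rho>' 5 = real (inv_fact_coeff m j)" "\<rho>' 0 = real j + 1" for \<rho>'
    unfolding inv_fact_coeff_Suc by (intro val_idiv) (use that in simp_all)
  have s: "real s - real k * (real m - real j) = real (s - k * (m - j))"
    using k j by (simp add: of_nat_diff)
  show ?thesis
    unfolding next_assigns_def state_def
    using simps k by (simp add: assigns_def \<rho> v5 s of_nat_diff rescale_def Let_def pick)
qed

text \<open>A round costs the body and the two jumps around it, hence
  \<open>length body_code + 2\<close> steps.\<close>

lemma body_step:
  fixes \<omega> :: "nat \<Rightarrow> real"
  assumes pc: "pc c = length init_code" and st: "state p s j u (reg c)"
    and le: "0 < p" "p \<le> n" and u: "0 \<le> u" "u < 1" and pos: "0 < level_total m p s j"
  defines "k \<equiv> pick m p s j u" and "c' \<equiv> (step sampler \<omega> ^^ (length body_code + 2)) c"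
  shows "pc c' = length init_code"
    "state (p - k) (s - k * (m - j)) (Suc j) (rescale m p s j u) (reg c')"
    "mem c' = (mem c)(j := real k)"
proof -
  note props = decode_step_props[OF u pos le(1), folded k_def]
  have j: "j \<le> m" using level_le[OF pos le(1)] .
  define c1 where "c1 = step sampler \<omega> c"
  have c1: "c1 = c\<lparr>pc := Suc (pc c)\<rparr>"
    using pc st le by (simp add: c1_def step_def halted_def sampler_def nth_append state_def)
  define c2 where "c2 = fold (exec \<omega>) (assign_code 30 pick_assigns) c1"
  define c3 where "c3 = exec \<omega> (Store 0 19) c2"
  define c4 where "c4 = fold (exec \<omega>) (assign_code 30 next_assigns) c3"
  have 2: "pc c2 = pc c1 + length (assign_code 30 pick_assigns)" "mem c2 = mem c"
    "\<And>i. i < 30 \<Longrightarrow> reg c2 i = assigns pick_assigns (reg c) i"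
    using assign_code_correct[OF pick_assigns_wf, of \<omega> c1] by (simp_all add: c2_def c1)
  note pick_st = pick_assigns_state[OF st le u pos, folded k_def]
  have st2: "state p s j u (reg c2)" by (rule state_cong[OF pick_st(1) 2(3)])
  have 3: "pc c3 = Suc (pc c2)" "mem c3 = (mem c)(j := real k)" "reg c3 = reg c2"
    using 2 pick_st st2 by (simp_all add: c3_def state_def address_def)
  have 4: "pc c4 = pc c3 + length (assign_code 30 next_assigns)" "mem c4 = mem c3"
    "\<And>i. i < 30 \<Longrightarrow> reg c4 i = assigns next_assigns (reg c2) i"
    using assign_code_correct[OF next_assigns_wf, of \<omega> c3] 3 by (simp_all add: c4_def)
  have "state (p - k) (s - k * (m - j)) (Suc j) (rescale m p s j u) (assigns next_assigns (reg c2))"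
    by (rule next_assigns_state[OF st2 j]) (use props pick_st 2(3) in \<open>simp_all add: k_def\<close>)
  then have st4: "state (p - k) (s - k * (m - j)) (Suc j) (rescale m p s j u) (reg c4)"
    by (rule state_cong) (rule 4(3))
  have body: "(step sampler \<omega> ^^ length body_code) c1 = c4"
  proof -
    have "(step sampler \<omega> ^^ length body_code) c1 = fold (exec \<omega>) body_code c1"
      by (rule run_straight[OF straight_body,
            of _ "init_code @ [JumpLe 3 11 (length init_code + length body_code + 2)]" _ "[JumpLe 11 11 (length init_code)]"])
        (simp_all add: c1 pc sampler_def)
    then show ?thesis by (simp add: body_code_def c4_def c3_def c2_def)
  qed
  have pc4: "pc c4 = length init_code + 1 + length body_code"
    using 2 3 4 c1 pc by (simp add: body_code_def)
  have "(step sampler \<omega> ^^ (length body_code + 2)) c = step sampler \<omega> ((step sampler \<omega> ^^ length body_code) (step sampler \<omega> c))"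
    by (simp add: funpow_swap1)
  then have "c' = step sampler \<omega> c4"
    by (simp only: c'_def c1_def[symmetric] body)
  also have "\<dots> = c4\<lparr>pc := length init_code\<rparr>"
    using pc4 by (simp add: step_def halted_def sampler_def nth_append)
  finally have c': "c' = c4\<lparr>pc := length init_code\<rparr>" .
  show "pc c' = length init_code" by (simp add: c')
  show "state (p - k) (s - k * (m - j)) (Suc j) (rescale m p s j u) (reg c')" using st4 by (simp add: c')
  show "mem c' = (mem c)(j := real k)" using 3 4 by (simp add: c')
qed

text \<open>Induction on the length of the decoded list, which is the number of rounds. The run
  stops at the exit test with the condition fulfilled; the one step of that jump is added in
  \<open>run_sampler\<close>.\<close>

lemma loop:
  assumes "pc c = length init_code" "state p s j u (reg c)" "p \<le> n" "0 \<le> u" "u < 1"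
    "0 < level_total m p s j"
  shows "\<exists>c'. (step sampler \<omega> ^^ ((length body_code + 2) * length (decode m p s j u))) c = c'
    \<and> pc c' = length init_code \<and> reg c' 3 \<le> reg c' 11 \<and> reg c' 0 = real (j + length (decode m p s j u))
    \<and> (\<forall>i<j. mem c' i = mem c i)
    \<and> (\<forall>i<length (decode m p s j u). mem c' (j + i) = real (decode m p s j u ! i))"
  using assms
proof (induction "length (decode m p s j u)" arbitrary: c p s j u)
  case 0
  then have "p = 0"
    using level_le[OF "0.prems"(6)] by (cases "p = 0") (auto simp: decode.simps[of m p s j u] Let_def)
  then show ?case using 0 by (simp add: state_def)
next
  case (Suc l)
  have p: "0 < p" using Suc.hyps(2) by (cases "p = 0") (auto simp: decode.simps)
  have j: "j \<le> m" using level_le[OF Suc.prems(6) p] .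
  define k where "k = pick m p s j u"
  define v where "v = decode m (p - k) (s - k * (m - j)) (Suc j) (rescale m p s j u)"
  have dec: "decode m p s j u = k # v"
    using p j by (subst decode.simps) (simp add: Let_def k_def v_def)
  define c1 where "c1 = (step sampler \<omega> ^^ (length body_code + 2)) c"
  note b = body_step[OF Suc.prems(1,2) p Suc.prems(3-6), of \<omega>, folded k_def, folded c1_def]
  note props = decode_step_props[OF Suc.prems(4-6) p, folded k_def]
  obtain c' where c': "(step sampler \<omega> ^^ ((length body_code + 2) * length v)) c1 = c'"
    "pc c' = length init_code" "reg c' 3 \<le> reg c' 11" "reg c' 0 = real (Suc j + length v)"
    "\<And>i. i < Suc j \<Longrightarrow> mem c' i = mem c1 i" "\<And>i. i < length v \<Longrightarrow> mem c' (Suc j + i) = real (v ! i)"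
    using Suc.hyps(1)[of "p - k" "s - k * (m - j)" "Suc j" "rescale m p s j u" c1]
      Suc.hyps(2) Suc.prems b props unfolding v_def[symmetric] dec by auto
  have "(step sampler \<omega> ^^ ((length body_code + 2) * length (k # v))) c = c'"
  proof -
    have "(length body_code + 2) * length (k # v) = (length body_code + 2) * length v + (length body_code + 2)"
      by simp
    then show ?thesis
      using c'(1) unfolding c1_def by (simp only: funpow_add comp_apply)
  qed
  moreover have "mem c' (j + i) = real ((k # v) ! i)" if "i < length (k # v)" for i
    using that c'(5)[of j] c'(6)[of "i - 1"] b(3) by (cases i) auto
  moreover have "mem c' i = mem c i" if "i < j" for i
    using that c'(5)[of i] b(3) by simp
  ultimately show ?case unfolding dec using c' by auto
qed

text \<open>A probability mass function has nonempty support, and any vector of positive probability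
  is valid and thus witnesses a positive total.\<close>

lemma level_total_init_pos:
  assumes "0 < n"
  shows "0 < level_total m n (m * n - m) 0"
proof -
  have "set_pmf (multinomial_bin_cardinalities n m) \<noteq> {}" by (rule set_pmf_not_empty)
  then obtain v where "pmf (multinomial_bin_cardinalities n m) v \<noteq> 0"
    by (auto simp: set_pmf_iff)
  then have "valid m n (m * n - m) 0 v"
    unfolding pmf_multinomial_bin_cardinalities[OF assms] valid_0_iff[OF assms] by (auto split: if_splits)
  then show ?thesis by (rule valid_total_pos)
qed

text \<open>The program takes the fractional part of its random number, so the value lies in
  \<open>[0, 1)\<close> for every \<open>\<omega>\<close> and termination is sure rather than almost
  sure.\<close>

lemma run_sampler:
  fixes \<omega> :: "nat \<Rightarrow> real"
  assumes "0 < n"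
  defines "v \<equiv> decode m n (m * n - m) 0 (frac (\<omega> 0))"
  shows "run_time sampler [real n, real m, K] \<omega>
      = enat (Suc (length init_code + (length body_code + 2) * length v))"
    and "run_output sampler [real n, real m, K] \<omega> = Some v"
proof -
  define c0 where "c0 = initial [real n, real m, K]"
  define c1 where "c1 = exec \<omega> (Uniform 7) c0"
  define c2 where "c2 = fold (exec \<omega>) (assign_code 30 init_assigns) c1"
  have reg1: "reg c1 0 = real n" "reg c1 1 = real m" "reg c1 11 = 0" "reg c1 7 = \<omega> 0" "pc c1 = 1"
    by (simp_all add: c1_def c0_def initial_def)
  have 2: "pc c2 = length init_code" "\<And>i. i < 30 \<Longrightarrow> reg c2 i = assigns init_assigns (reg c1) i"
    using assign_code_correct[OF init_assigns_wf, of \<omega> c1] reg1 by (simp_all add: c2_def init_code_def)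
  have "state n (m * n - m) 0 (frac (\<omega> 0)) (assigns init_assigns (reg c1))"
    using init_assigns_state[OF assms(1) reg1(1-3)] reg1(4) by simp
  then have st: "state n (m * n - m) 0 (frac (\<omega> 0)) (reg c2)"
    by (rule state_cong) (rule 2(2))
  have init: "(step sampler \<omega> ^^ length init_code) c0 = c2"
  proof -
    have "(step sampler \<omega> ^^ length init_code) c0 = fold (exec \<omega>) init_code c0"
      by (rule run_straight[OF straight_init, of _ "[]" _
        "[JumpLe 3 11 (length init_code + length body_code + 2)] @ body_code @ [JumpLe 11 11 (length init_code)]"])
        (simp_all add: c0_def initial_def sampler_def)
    then show ?thesis by (simp add: init_code_def c2_def c1_def)
  qed
  obtain c3 where c3: "(step sampler \<omega> ^^ ((length body_code + 2) * length v)) c2 = c3"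
    "pc c3 = length init_code" "reg c3 3 \<le> reg c3 11" "reg c3 0 = real (length v)"
    "\<And>i. i < length v \<Longrightarrow> mem c3 i = real (v ! i)"
    using loop[OF 2(1) st order_refl frac_ge_0 frac_lt_1 level_total_init_pos[OF assms(1)], of \<omega>]
    unfolding v_def[symmetric] by auto
  define t where "t = length init_code + (length body_code + 2) * length v"
  have at_t: "config_at sampler [real n, real m, K] \<omega> t = c3"
    unfolding config_at_def c0_def[symmetric] t_def
    by (subst add.commute, subst funpow_add) (simp only: comp_apply init c3(1))
  have at_Suc: "config_at sampler [real n, real m, K] \<omega> (Suc t) = c3\<lparr>pc := length sampler\<rparr>"
  proof -
    have "config_at sampler [real n, real m, K] \<omega> (Suc t) = step sampler \<omega> c3"
      using at_t by (simp add: config_at_def)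
    also have "\<dots> = c3\<lparr>pc := length sampler\<rparr>"
      using c3 by (simp add: step_def halted_def sampler_def nth_append)
    finally show ?thesis .
  qed
  show time: "run_time sampler [real n, real m, K] \<omega> = enat (Suc t)"
    by (rule run_time_eqI) (simp_all only: at_t at_Suc, simp_all add: halted_def c3 sampler_def)
  show "run_output sampler [real n, real m, K] \<omega> = Some v"
    by (rule run_output_eqI[OF time]) (use c3 in \<open>simp add: at_Suc holds_vector_def\<close>)
qed

end

section \<open>The law of the output\<close>

definition unit_uniform :: "real measure" where
  "unit_uniform = uniform_measure lborel {0<..<1}"

lemma prob_space_unit_uniform: "prob_space unit_uniform"
  unfolding unit_uniform_def by (rule prob_space_uniform_measure) auto

lemma sets_unit_uniform [simp, measurable_cong]: "sets unit_uniform = sets borel"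
  by (simp add: unit_uniform_def)

lemma space_unit_uniform [simp]: "space unit_uniform = UNIV"
  by (simp add: unit_uniform_def)

lemma distr_uniforms_component: "distr uniforms unit_uniform (\<lambda>\<omega>. \<omega> i) = unit_uniform"
proof -
  interpret product_prob_space "\<lambda>_. unit_uniform" UNIV
    by (rule product_prob_spaceI) (rule prob_space_unit_uniform)
  show ?thesis
    unfolding uniforms_def unit_uniform_def[symmetric] by (rule PiM_component) simp
qed

lemma measurable_uniforms_component [measurable]: "(\<lambda>\<omega>. \<omega> i) \<in> measurable uniforms unit_uniform"
  unfolding uniforms_def unit_uniform_def[symmetric] by (rule measurable_component_singleton) simp

lemma space_uniforms [simp]: "space uniforms = UNIV"
  by (auto simp: uniforms_def space_PiM PiE_def extensional_def)

lemma emeasure_unit_uniform_frac: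
  assumes "0 \<le> a" "0 \<le> l" "a + l \<le> 1"
  shows "{x. a \<le> frac x \<and> frac x < a + l} \<in> sets borel"
    and "emeasure unit_uniform {x. a \<le> frac x \<and> frac x < a + l} = ennreal l"
proof -
  show meas: "{x. a \<le> frac x \<and> frac x < a + l} \<in> sets borel"
    unfolding frac_def by measurable
  have "emeasure unit_uniform {x. a \<le> frac x \<and> frac x < a + l}
      = emeasure lborel ({0<..<1} \<inter> {x. a \<le> frac x \<and> frac x < a + l})"
    unfolding unit_uniform_def using meas by (subst emeasure_uniform_measure) (auto simp: divide_ennreal_def)
  also have "\<dots> = emeasure lborel {a..<a + l}"
  proof (rule emeasure_eq_AE)
    \<comment> \<open>The open unit interval omits 0, which belongs to \<open>{a..<a + l}\<close>
      when \<open>a = 0\<close> and \<open>l > 0\<close>: a null set.\<close>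
    show "AE x in lborel. (x \<in> {0<..<1} \<inter> {x. a \<le> frac x \<and> frac x < a + l}) = (x \<in> {a..<a + l})"
      using AE_lborel_singleton[of 0]
    proof eventually_elim
      case (elim x)
      have "frac x = x" if "0 < x" "x < 1" using that by (simp add: frac_eq)
      then show ?case using elim assms by auto
    qed
  qed (use meas in auto)
  also have "\<dots> = ennreal l" using assms by simp
  finally show "emeasure unit_uniform {x. a \<le> frac x \<and> frac x < a + l} = ennreal l" .
qed

context
  fixes n m :: nat
  assumes n: "0 < n"
begin

definition sample :: "real \<Rightarrow> nat list" where
  "sample x = decode m n (m * n - m) 0 (frac x)"

lemma total_pos: "0 < level_total m n (m * n - m) 0"
  by (rule packing.level_total_init_pos[OF n])

lemma sample_vimage:
  "sample -` {v} \<in> sets borel \<and> emeasure unit_uniform (sample -` {v})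
    = ennreal (if valid m n (m * n - m) 0 v
        then real (weight m n 0 v) / real (level_total m n (m * n - m) 0) else 0)"
proof (cases "valid m n (m * n - m) 0 v")
  case True
  define l where "l = real (weight m n 0 v) / real (level_total m n (m * n - m) 0)"
  obtain a where a: "0 \<le> a" "a + l \<le> 1"
    "\<And>u. 0 \<le> u \<Longrightarrow> u < 1 \<Longrightarrow> decode m n (m * n - m) 0 u = v \<longleftrightarrow> a \<le> u \<and> u < a + l"
    using decode_eq_iff[OF True] unfolding l_def by blast
  have l: "0 \<le> l" by (simp add: l_def)
  have "sample -` {v} = {x. a \<le> frac x \<and> frac x < a + l}"
    by (intro set_eqI) (simp only: vimage_eq singleton_iff mem_Collect_eq sample_def a(3)[OF frac_ge_0 frac_lt_1])
  then show ?thesis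
    using emeasure_unit_uniform_frac[OF a(1) l a(2)] True by (simp add: l_def)
next
  case False
  have "sample x \<noteq> v" for x
    unfolding sample_def using False decode_valid[OF frac_ge_0[of x] frac_lt_1 total_pos] by metis
  then have "sample -` {v} = {}" by blast
  then show ?thesis using False by simp
qed

lemma measurable_sample [measurable]: "sample \<in> measurable unit_uniform (count_space UNIV)"
  by (rule measurable_count_space_eq2_countable[THEN iffD2]) (use sample_vimage in auto)

text \<open>All point masses are \<open>c\<close> times those of the target, and both laws have
  total mass 1, so \<open>c = 1\<close>. This spares summing the weights over all vectors.\<close>

lemma distr_sample:
  "distr unit_uniform (count_space UNIV) sample = measure_pmf (multinomial_bin_cardinalities n m)"
proof -
  let ?D = "distr unit_uniform (count_space UNIV) sample"
  let ?M = "multinomial_bin_cardinalities n m"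
  interpret D: prob_space ?D
    by (rule prob_space.prob_space_distr[OF prob_space_unit_uniform measurable_sample])
  define c where "c = real n ^ m * fact m ^ n / fact m / real (level_total m n (m * n - m) 0)"
  have c: "0 \<le> c" by (simp add: c_def)
  have single: "emeasure ?D {v} = ennreal c * ennreal (pmf ?M v)" for v
  proof -
    have "emeasure ?D {v} = ennreal ((if valid m n (m * n - m) 0 v then real (weight m n 0 v) else 0)
        / real (level_total m n (m * n - m) 0))"
      using sample_vimage[of v] by (simp add: emeasure_distr)
    also have "\<dots> = ennreal (c * pmf ?M v)"
      unfolding weight_eq_pmf[OF n] by (simp add: c_def)
    finally show ?thesis using c by (simp add: ennreal_mult)
  qed
  have "1 = emeasure ?D UNIV" using D.emeasure_space_1 by simp
  also have "\<dots> = (\<integral>\<^sup>+ v. emeasure ?D {v} \<partial>count_space UNIV)"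
    by (rule emeasure_countable_singleton) auto
  also have "\<dots> = ennreal c * (\<integral>\<^sup>+ v. ennreal (pmf ?M v) \<partial>count_space UNIV)"
    unfolding single by (rule nn_integral_cmult) simp
  also have "\<dots> = ennreal c" by (simp add: nn_integral_pmf)
  finally have "ennreal c = 1" by simp
  then show ?thesis
    by (intro measure_eqI_countable[where A = UNIV]) (auto simp: single emeasure_pmf_single)
qed

lemma measurable_sample_component [measurable]:
  "(\<lambda>\<omega>. sample (\<omega> 0)) \<in> measurable uniforms (count_space UNIV)"
  by measurable

lemma distr_sample_component:
  "distr uniforms (count_space UNIV) (\<lambda>\<omega>. sample (\<omega> 0))
    = measure_pmf (multinomial_bin_cardinalities n m)"
proof -
  have "distr uniforms (count_space UNIV) (\<lambda>\<omega>. sample (\<omega> 0))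
      = distr (distr uniforms unit_uniform (\<lambda>\<omega>. \<omega> 0)) (count_space UNIV) sample"
    by (subst distr_distr) (auto simp: o_def)
  then show ?thesis by (simp only: distr_uniforms_component distr_sample)
qed

end

theorem theorem2:
  shows "\<exists>C::real. C > 0 \<and> (\<exists>P::program. \<forall>(n::nat) (m::nat) (K::real).
    2 \<le> n \<longrightarrow> n \<le> m \<longrightarrow> real m \<le> real n * ln (real n) \<longrightarrow>
    10 * (ln (real n) / ln (4 * real n / real m * ln (real n))) \<le> K \<longrightarrow>
    K \<le> 8 * ln (real n) ^ 5 \<longrightarrow>
    (let T = run_time P [real n, real m, K];
         X = run_output P [real n, real m, K]
     in
       distr uniforms (count_space UNIV) X
         = measure_pmf (map_pmf Some (multinomial_bin_cardinalities n m)) \<and>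
       T \<in> measurable uniforms (count_space UNIV) \<and>
       (\<integral>\<^sup>+ \<omega>. ennreal_of_enat (T \<omega>) \<partial>uniforms) \<le> ennreal (C * K) \<and>
       measure uniforms {\<omega> \<in> space uniforms. ennreal_of_enat (T \<omega>) \<le> ennreal (C * K)}
         \<ge> 1 - exp (- (1 / 4) * K powr (1 / 5))))"
proof -
  define a where "a = Suc (length init_code)"
  define b where "b = length body_code + 2"
  \<comment> \<open>As \<open>K \<ge> 1\<close>, both \<open>a + b * (3 * K)\<close> for the mean
    and \<open>a + b * (2 * K + 1)\<close> off the exceptional event are at most
    \<open>(a + 3 * b) * K\<close>.\<close>
  define C where "C = real a + 3 * real b"
  have main: "let T = run_time sampler [real n, real m, K];
         X = run_output sampler [real n, real m, K]
     in
       distr uniforms (count_space UNIV) X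
         = measure_pmf (map_pmf Some (multinomial_bin_cardinalities n m)) \<and>
       T \<in> measurable uniforms (count_space UNIV) \<and>
       (\<integral>\<^sup>+ \<omega>. ennreal_of_enat (T \<omega>) \<partial>uniforms) \<le> ennreal (C * K) \<and>
       measure uniforms {\<omega> \<in> space uniforms. ennreal_of_enat (T \<omega>) \<le> ennreal (C * K)}
         \<ge> 1 - exp (- (1 / 4) * K powr (1 / 5))"
    if "2 \<le> n" "n \<le> m" "real m \<le> real n * ln (real n)"
      "10 * (ln (real n) / ln (4 * real n / real m * ln (real n))) \<le> K" for n m :: nat and K :: real
  proof -
    interpret admissible n m K by unfold_locales (fact that)+
    have n0: "0 < n" using that by simp
    let ?M = "multinomial_bin_cardinalities n m"
    note [measurable] = measurable_sample_component[OF n0]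
    define S where "S \<omega> = sample n m (\<omega> 0)" for \<omega> :: "nat \<Rightarrow> real"
    have S_meas [measurable]: "S \<in> measurable uniforms (count_space UNIV)"
      unfolding S_def by measurable
    have S_distr: "distr uniforms (count_space UNIV) S = measure_pmf ?M"
      unfolding S_def by (rule distr_sample_component[OF n0])
    have T: "run_time sampler [real n, real m, K] = (\<lambda>\<omega>. enat (a + b * length (S \<omega>)))"
      and X: "run_output sampler [real n, real m, K] = (\<lambda>\<omega>. Some (S \<omega>))"
      using packing.run_sampler[OF n0] by (auto simp: fun_eq_iff a_def b_def S_def sample_def[OF n0])
    have "distr uniforms (count_space UNIV) (\<lambda>\<omega>. Some (S \<omega>))
        = distr (distr uniforms (count_space UNIV) S) (count_space UNIV) Some"
      by (subst distr_distr) (auto simp: o_def)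
    then have law: "distr uniforms (count_space UNIV) (\<lambda>\<omega>. Some (S \<omega>)) = measure_pmf (map_pmf Some ?M)"
      by (simp only: S_distr map_pmf_rep_eq)
    have "(\<integral>\<^sup>+ \<omega>. ennreal_of_enat (enat (a + b * length (S \<omega>))) \<partial>uniforms)
        = (\<integral>\<^sup>+ v. ennreal (real (a + b * length v)) \<partial>distr uniforms (count_space UNIV) S)"
      by (subst nn_integral_distr) (auto simp: ennreal_of_nat_eq_real_of_nat)
    also have "\<dots> = (\<integral>\<^sup>+ v. ennreal (real a) + ennreal (real b) * ennreal (real (length v)) \<partial>measure_pmf ?M)"
      unfolding S_distr by (intro nn_integral_cong) (simp add: ennreal_plus flip: ennreal_mult)
    also have "\<dots> = ennreal (real a) + ennreal (real b) * (\<integral>\<^sup>+ v. ennreal (real (length v)) \<partial>measure_pmf ?M)"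
      by (simp add: nn_integral_add nn_integral_cmult)
    also have "\<dots> \<le> ennreal (real a) + ennreal (real b) * ennreal (3 * K)"
      by (intro add_left_mono mult_left_mono expected_length) simp
    also have "\<dots> = ennreal (real a + real b * (3 * K))"
      using K_ge by (simp add: ennreal_plus ennreal_mult)
    also have "\<dots> \<le> ennreal (C * K)"
      using K_ge by (intro ennreal_leI) (simp add: C_def distrib_right mult_le_cancel_left1)
    finally have mean: "(\<integral>\<^sup>+ \<omega>. ennreal_of_enat (enat (a + b * length (S \<omega>))) \<partial>uniforms) \<le> ennreal (C * K)" .
    have "measure_pmf.prob ?M {v. real (length v) \<le> 2 * K + 1}
       \<le> measure_pmf.prob ?M {v. ennreal_of_enat (enat (a + b * length v)) \<le> ennreal (C * K)}"
    proof (intro measure_pmf.finite_measure_mono subsetI CollectI)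
      fix v :: "nat list" assume "v \<in> {v. real (length v) \<le> 2 * K + 1}"
      then have "real b * real (length v) \<le> real b * (2 * K + 1)" by (intro mult_left_mono) auto
      moreover have "real a * 1 \<le> real a * K" "real b * 1 \<le> real b * K"
        using K_ge by (intro mult_left_mono; simp)+
      ultimately have "real (a + b * length v) \<le> C * K"
        by (simp add: C_def algebra_simps)
      then show "ennreal_of_enat (enat (a + b * length v)) \<le> ennreal (C * K)"
        by (simp only: ennreal_of_enat_enat ennreal_of_nat_eq_real_of_nat ennreal_leI)
    qed simp
    also have "\<dots> = measure uniforms {\<omega> \<in> space uniforms. ennreal_of_enat (enat (a + b * length (S \<omega>))) \<le> ennreal (C * K)}"
      unfolding S_distr[symmetric] by (subst measure_distr) (auto intro!: arg_cong[of _ _ "measure uniforms"])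
    finally have tail: "1 - exp (- (1 / 4) * K powr (1 / 5))
        \<le> measure uniforms {\<omega> \<in> space uniforms. ennreal_of_enat (enat (a + b * length (S \<omega>))) \<le> ennreal (C * K)}"
      using prob_short by linarith
    have meas: "(\<lambda>\<omega>. enat (a + b * length (S \<omega>))) \<in> measurable uniforms (count_space UNIV)"
      by (rule measurable_compose[OF S_meas]) simp
    show ?thesis
      unfolding T X Let_def by (intro conjI law meas mean tail)
  qed
  have "0 < C" by (simp add: C_def a_def)
  then show ?thesis using main by blast
qed

end
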